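(* Let $D$ be a period domain with automorphism group $G_{\mathbb R}$, and let $(F^\bullet,N)$ be an $\mathbb R$-split nilpotent orbit on $D$ with Deligne bigrading $\mathfrak g_{\mathbb C}=\bigoplus\mathfrak g^{p,q}$. Let $M^0_{\mathbb R}\subset G_{\mathbb R}$ be the connected Lie subgroup with Lie algebra $\mathfrak g^{0,0}_{\mathbb R}$. (a) The orbit $\mathcal N^0:=\mathrm{Ad}(M^0_{\mathbb R})\cdot N$ is open in $\mathfrak g^{-1,-1}_{\mathbb R}$. (b) Let $\mathcal W_N^\circ$ be the connected component of $$\mathcal W_N:=\{N'\in\mathfrak g^{-1,-1}_{\mathbb R}\mid W(N)=W(N')\}$$ containing $N$. Then $\mathcal W_N^\circ=\mathcal N^0$.
   Context: $V_{\mathbb R}$ is a finite dimensional real vector space with a rational structure, $w\in\mathbb Z$, and $Q$ is a nondegenerate $(-1)^w$-symmetric bilinear form on $V_{\mathbb R}$ defined over $\mathbb Q$. $D$ is the period domain of weight $w$, $Q$-polarized Hodge structures on $V$ with fixed Hodge numbers, $\check D$ is its compact dual, $G_{\mathbb R}=\mathrm{Aut}(V_{\mathbb R},Q)$, with Lie algebra $\mathfrak g_{\mathbb R}=\mathrm{End}(V_{\mathbb R},Q)$ and complexification $\mathfrak g_{\mathbb C}$. A one-variable nilpotent orbit $(F^\bullet,N)$ on $D$ consists of $F^\bullet\in\check D$ and a nilpotent $N\in\mathfrak g_{\mathbb R}$ with $NF^p\subset F^{p-1}$ and $\exp(zN)F^\bullet\in D$ for $\mathrm{Im}\,z\gg0$.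 $W(N)$ denotes the monodromy weight filtration of $N$ on $V$; with the shift by $w$, $(F^\bullet,W(N))$ is a polarized mixed Hodge structure, and the nilpotent orbit is $\mathbb R$-split if this mixed Hodge structure is split over $\mathbb R$. $V_{\mathbb C}=\bigoplus V^{p,q}$ is its Deligne bigrading, $\mathfrak g^{p,q}=\{X\in\mathfrak g_{\mathbb C}\mid X(V^{r,s})\subset V^{r+p,s+q}\ \forall r,s\}$, and $\mathfrak g^{p,p}_{\mathbb R}=\mathfrak g_{\mathbb R}\cap\mathfrak g^{p,p}$. *)

theory Defs
  imports "HOL-Analysis.Analysis"
begin

text \<open>
  Conventions: \<open>V\<close> is \<open>real^'n\<close>, its complexification is \<open>complex^'n\<close>, and endomorphisms are
  square matrices acting by \<open>*v\<close>. Real subspaces are \<open>subspace\<close>; complex subspaces, spans and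
  dimensions are \<open>vec.subspace\<close>, \<open>vec.span\<close>, \<open>vec.dim\<close>. A filtration is a family of subspaces
  indexed by all integers.
\<close>

definition cvec :: "real^'n \<Rightarrow> complex^'n" where
  "cvec x = (\<chi> i. complex_of_real (x $ i))"

definition cmat :: "real^'n^'m \<Rightarrow> complex^'n^'m" where
  "cmat = map_matrix complex_of_real"

definition conj_vec :: "complex^'n \<Rightarrow> complex^'n" where
  "conj_vec v = (\<chi> i. cnj (v $ i))"

definition complexify :: "(real^'n) set \<Rightarrow> (complex^'n) set" where
  "complexify S = vec.span (cvec ` S)"

definition complex_form :: "(real^'n \<Rightarrow> real^'n \<Rightarrow> real) \<Rightarrow> complex^'n \<Rightarrow> complex^'n \<Rightarrow> complex" where
  "complex_form Q u v =
     (\<Sum>i\<in>UNIV. \<Sum>j\<in>UNIV. u $ i * v $ j * complex_of_real (Q (axis i 1) (axis j 1)))"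

text \<open>Class multiplication on \<open>'a^'n^'n\<close> is componentwise, so \<open>^\<close> is not the matrix power, and the
  library \<open>exp\<close> is not available for matrices.\<close>

definition mat_pow :: "'a::semiring_1^'n^'n \<Rightarrow> nat \<Rightarrow> 'a^'n^'n" where
  "mat_pow A k = (((**) A) ^^ k) (mat 1)"

definition mat_exp :: "'a::real_normed_field^'n^'n \<Rightarrow> 'a^'n^'n" where
  "mat_exp A = (\<Sum>k. (1 / fact k) *\<^sub>R mat_pow A k)"

definition mat_scale :: "'a::times \<Rightarrow> 'a^'n^'m \<Rightarrow> 'a^'n^'m" where
  "mat_scale z = map_matrix ((*) z)"

definition mat_nilpotent :: "'a::semiring_1^'n^'n \<Rightarrow> bool" where
  "mat_nilpotent A \<longleftrightarrow> (\<exists>k. mat_pow A k = 0)"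

text \<open>A rational structure: a \<open>\<rat>\<close>-subspace \<open>VQ\<close> with \<open>VQ \<otimes> \<real> = V\<close>.\<close>

definition rational_structure :: "(real^'n) set \<Rightarrow> bool" where
  "rational_structure VQ \<longleftrightarrow>
     (\<exists>B. independent B \<and> span B = UNIV \<and>
          VQ = {\<Sum>b\<in>B. c b *\<^sub>R b | c. \<forall>b\<in>B. c b \<in> \<rat>})"

definition polarization_form ::
  "int \<Rightarrow> (real^'n) set \<Rightarrow> (real^'n \<Rightarrow> real^'n \<Rightarrow> real) \<Rightarrow> bool" where
  "polarization_form w VQ Q \<longleftrightarrow>
     bilinear Q \<and>
     (\<forall>x y. Q y x = (-1) powi w * Q x y) \<and>
     (\<forall>x. (\<forall>y. Q x y = 0) \<longrightarrow> x = 0) \<and>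
     (\<forall>x\<in>VQ. \<forall>y\<in>VQ. Q x y \<in> \<rat>)"

definition aut_group :: "(real^'n \<Rightarrow> real^'n \<Rightarrow> real) \<Rightarrow> (real^'n^'n) set" where
  "aut_group Q = {g. invertible g \<and> (\<forall>x y. Q (g *v x) (g *v y) = Q x y)}"

definition lie_g_real :: "(real^'n \<Rightarrow> real^'n \<Rightarrow> real) \<Rightarrow> (real^'n^'n) set" where
  "lie_g_real Q = {X. \<forall>x y. Q (X *v x) y + Q x (X *v y) = 0}"

definition lie_g_complex :: "(real^'n \<Rightarrow> real^'n \<Rightarrow> real) \<Rightarrow> (complex^'n^'n) set" where
  "lie_g_complex Q = {X. \<forall>u v. complex_form Q (X *v u) v + complex_form Q u (X *v v) = 0}"

text \<open>\<open>h p\<close> is the Hodge number of type \<open>(p, w - p)\<close>, and \<open>d\<close> is the dimension of \<open>V\<close>.\<close>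

definition hodge_numbers :: "int \<Rightarrow> (int \<Rightarrow> nat) \<Rightarrow> nat \<Rightarrow> bool" where
  "hodge_numbers w h d \<longleftrightarrow>
     finite {p. h p \<noteq> 0} \<and> (\<Sum>p | h p \<noteq> 0. h p) = d \<and> (\<forall>p. h (w - p) = h p)"

definition decreasing_filtration :: "(int \<Rightarrow> (complex^'n) set) \<Rightarrow> bool" where
  "decreasing_filtration F \<longleftrightarrow>
     (\<forall>p. vec.subspace (F p)) \<and> antimono F \<and> (\<exists>p. F p = UNIV) \<and> (\<exists>p. F p = {0})"

definition compact_dual ::
  "int \<Rightarrow> (real^'n \<Rightarrow> real^'n \<Rightarrow> real) \<Rightarrow> (int \<Rightarrow> nat) \<Rightarrow> (int \<Rightarrow> (complex^'n) set) set" where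
  "compact_dual w Q h =
     {F. decreasing_filtration F \<and>
         (\<forall>p. vec.dim (F p) = vec.dim (F (p + 1)) + h p) \<and>
         (\<forall>p. \<forall>u\<in>F p. \<forall>v\<in>F (w + 1 - p). complex_form Q u v = 0)}"

text \<open>On \<open>V\<^sup>p\<^sup>,\<^sup>q = F\<^sup>p \<inter> conj F\<^sup>q\<close> with \<open>q = w - p\<close>, the second Riemann relation is
  \<open>i\<^sup>p\<^sup>-\<^sup>q Q(v, conj v) > 0\<close>.\<close>

definition period_domain ::
  "int \<Rightarrow> (real^'n \<Rightarrow> real^'n \<Rightarrow> real) \<Rightarrow> (int \<Rightarrow> nat) \<Rightarrow> (int \<Rightarrow> (complex^'n) set) set" where
  "period_domain w Q h =
     {F \<in> compact_dual w Q h.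
        (\<forall>p. F p \<inter> conj_vec ` F (w + 1 - p) = {0} \<and>
             vec.span (F p \<union> conj_vec ` F (w + 1 - p)) = UNIV) \<and>
        (\<forall>p. \<forall>v \<in> F p \<inter> conj_vec ` F (w - p). v \<noteq> 0 \<longrightarrow>
             \<i> powi (2 * p - w) * complex_form Q v (conj_vec v) \<in> \<real> \<and>
             Re (\<i> powi (2 * p - w) * complex_form Q v (conj_vec v)) > 0)}"

definition nilpotent_orbit ::
  "int \<Rightarrow> (real^'n \<Rightarrow> real^'n \<Rightarrow> real) \<Rightarrow> (int \<Rightarrow> nat) \<Rightarrow> (int \<Rightarrow> (complex^'n) set) \<Rightarrow> real^'n^'n \<Rightarrow> bool"
  where
  "nilpotent_orbit w Q h F N \<longleftrightarrow>
     F \<in> compact_dual w Q h \<and> N \<in> lie_g_real Q \<and> mat_nilpotent N \<and>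
     (\<forall>p. (*v) (cmat N) ` F p \<subseteq> F (p - 1)) \<and>
     (\<exists>c::real. \<forall>z. Im z > c \<longrightarrow>
        (\<lambda>p. (*v) (mat_exp (mat_scale z (cmat N))) ` F p) \<in> period_domain w Q h)"

definition increasing_filtration :: "(int \<Rightarrow> (real^'n) set) \<Rightarrow> bool" where
  "increasing_filtration W \<longleftrightarrow>
     (\<forall>k. subspace (W k)) \<and> mono W \<and> (\<exists>k. W k = {0}) \<and> (\<exists>k. W k = UNIV)"

text \<open>The last two conjuncts are injectivity and surjectivity of
  \<open>N\<^sup>k : W\<^sub>k / W\<^sub>k\<^sub>-\<^sub>1 \<rightarrow> W\<^sub>-\<^sub>k / W\<^sub>-\<^sub>k\<^sub>-\<^sub>1\<close>, written out on representatives.\<close>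

definition is_weight_filtration :: "real^'n^'n \<Rightarrow> (int \<Rightarrow> (real^'n) set) \<Rightarrow> bool" where
  "is_weight_filtration N W \<longleftrightarrow>
     increasing_filtration W \<and>
     (\<forall>k. (*v) N ` W k \<subseteq> W (k - 2)) \<and>
     (\<forall>k::nat. \<forall>x \<in> W (int k). mat_pow N k *v x \<in> W (- int k - 1) \<longrightarrow> x \<in> W (int k - 1)) \<and>
     (\<forall>k::nat. \<forall>y \<in> W (- int k). \<exists>x \<in> W (int k). y - mat_pow N k *v x \<in> W (- int k - 1))"

text \<open>Existence and uniqueness of this filtration for nilpotent \<open>N\<close> are standard.\<close>

definition weight_filtration :: "real^'n^'n \<Rightarrow> int \<Rightarrow> (real^'n) set" where
  "weight_filtration N = (THE W. is_weight_filtration N W)"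

definition shifted_weight_filtration :: "int \<Rightarrow> real^'n^'n \<Rightarrow> int \<Rightarrow> (real^'n) set" where
  "shifted_weight_filtration w N k = weight_filtration N (k - w)"

text \<open>\<open>F\<close> induces on each \<open>Gr\<^sub>k = W\<^sub>k / W\<^sub>k\<^sub>-\<^sub>1\<close> (complexified) a Hodge structure of weight \<open>k\<close>. The
  subspace \<open>Fgr k p\<close> is the preimage in \<open>W\<^sub>k\<close> of \<open>F\<^sup>p Gr\<^sub>k\<close>; the two conditions say that
  \<open>Gr\<^sub>k\<close> is the direct sum of \<open>F\<^sup>p Gr\<^sub>k\<close> and the conjugate of \<open>F\<^sup>k\<^sup>+\<^sup>1\<^sup>-\<^sup>p Gr\<^sub>k\<close>.\<close>

definition mixed_hodge_structure ::
  "(int \<Rightarrow> (complex^'n) set) \<Rightarrow> (int \<Rightarrow> (real^'n) set) \<Rightarrow> bool" where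
  "mixed_hodge_structure F W \<longleftrightarrow>
     decreasing_filtration F \<and> increasing_filtration W \<and>
     (let Fgr = (\<lambda>k p. vec.span ((F p \<inter> complexify (W k)) \<union> complexify (W (k - 1)))) in
      \<forall>k p. Fgr k p \<inter> conj_vec ` Fgr k (k + 1 - p) = complexify (W (k - 1)) \<and>
            vec.span (Fgr k p \<union> conj_vec ` Fgr k (k + 1 - p)) = complexify (W k))"

definition bigrading :: "(int \<Rightarrow> int \<Rightarrow> (complex^'n) set) \<Rightarrow> bool" where
  "bigrading V \<longleftrightarrow>
     (\<forall>p q. vec.subspace (V p q)) \<and>
     (\<forall>v. \<exists>!f. (\<forall>p q. f (p, q) \<in> V p q) \<and> finite {x. f x \<noteq> 0} \<and> v = (\<Sum>x | f x \<noteq> 0. f x))"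

text \<open>The Deligne bigrading of a mixed Hodge structure \<open>(F, W)\<close> is the unique bigrading with
  \<open>F\<^sup>p = \<Oplus>\<^sub>r\<^sub>\<ge>\<^sub>p V\<^sup>r\<^sup>,\<^sup>s\<close>, \<open>W\<^sub>k = \<Oplus>\<^sub>r\<^sub>+\<^sub>s\<^sub>\<le>\<^sub>k V\<^sup>r\<^sup>,\<^sup>s\<close>, and
  \<open>conj V\<^sup>p\<^sup>,\<^sup>q = V\<^sup>q\<^sup>,\<^sup>p\<close> modulo the sum of the \<open>V\<^sup>r\<^sup>,\<^sup>s\<close> with \<open>r < q\<close> and \<open>s < p\<close>.\<close>

definition deligne_bigrading ::
  "(int \<Rightarrow> (complex^'n) set) \<Rightarrow> (int \<Rightarrow> (real^'n) set) \<Rightarrow> (int \<Rightarrow> int \<Rightarrow> (complex^'n) set) \<Rightarrow> bool"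
  where
  "deligne_bigrading F W V \<longleftrightarrow>
     mixed_hodge_structure F W \<and> bigrading V \<and>
     (\<forall>p. F p = vec.span (\<Union>{V r s | r s. r \<ge> p})) \<and>
     (\<forall>k. complexify (W k) = vec.span (\<Union>{V r s | r s. r + s \<le> k})) \<and>
     (\<forall>p q. vec.span (conj_vec ` V p q \<union> \<Union>{V r s | r s. r < q \<and> s < p}) =
            vec.span (V q p \<union> \<Union>{V r s | r s. r < q \<and> s < p}))"

definition split_over_reals :: "(int \<Rightarrow> int \<Rightarrow> (complex^'n) set) \<Rightarrow> bool" where
  "split_over_reals V \<longleftrightarrow> (\<forall>p q. conj_vec ` V p q = V q p)"

definition lie_g_bigraded ::
  "(real^'n \<Rightarrow> real^'n \<Rightarrow> real) \<Rightarrow> (int \<Rightarrow> int \<Rightarrow> (complex^'n) set) \<Rightarrow> int \<Rightarrow> int \<Rightarrow> (complex^'n^'n) set"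
  where
  "lie_g_bigraded Q V p q =
     {X \<in> lie_g_complex Q. \<forall>r s. (*v) X ` V r s \<subseteq> V (r + p) (s + q)}"

definition lie_g_diag_real ::
  "(real^'n \<Rightarrow> real^'n \<Rightarrow> real) \<Rightarrow> (int \<Rightarrow> int \<Rightarrow> (complex^'n) set) \<Rightarrow> int \<Rightarrow> (real^'n^'n) set" where
  "lie_g_diag_real Q V p = {X \<in> lie_g_real Q. cmat X \<in> lie_g_bigraded Q V p p}"

definition lie_algebra_of :: "(real^'n^'n) set \<Rightarrow> (real^'n^'n) set" where
  "lie_algebra_of H = {X. \<forall>t::real. mat_exp (t *\<^sub>R X) \<in> H}"

text \<open>A connected Lie subgroup of a matrix Lie group need not be closed. The definition is the one in
  B. C. Hall, Lie Groups, Lie Algebras, and Representations: the Lie algebra is a vector subspace, and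
  every element is a finite product of exponentials of elements of it. Such a subgroup is determined
  by its Lie algebra.\<close>

definition connected_lie_subgroup :: "(real^'n^'n) set \<Rightarrow> (real^'n^'n) set \<Rightarrow> bool" where
  "connected_lie_subgroup G H \<longleftrightarrow>
     H \<subseteq> G \<and> mat 1 \<in> H \<and> (\<forall>a\<in>H. \<forall>b\<in>H. a ** b \<in> H) \<and> (\<forall>a\<in>H. matrix_inv a \<in> H) \<and>
     subspace (lie_algebra_of H) \<and> lie_algebra_of H \<subseteq> lie_algebra_of G \<and>
     (\<forall>a\<in>H. \<exists>Xs. set Xs \<subseteq> lie_algebra_of H \<and> a = foldr (**) (map mat_exp Xs) (mat 1))"

definition Ad_orbit :: "(real^'n^'n) set \<Rightarrow> real^'n^'n \<Rightarrow> (real^'n^'n) set" where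
  "Ad_orbit M N = {g ** N ** matrix_inv g | g. g \<in> M}"

definition same_weight_locus ::
  "(real^'n \<Rightarrow> real^'n \<Rightarrow> real) \<Rightarrow> (int \<Rightarrow> int \<Rightarrow> (complex^'n) set) \<Rightarrow> real^'n^'n \<Rightarrow> (real^'n^'n) set"
  where
  "same_weight_locus Q V N =
     {N' \<in> lie_g_diag_real Q V (-1). weight_filtration N = weight_filtration N'}"

end

theory Submission
  imports Defs
begin

text \<open>
  Let \<open>W\<close> be the weight filtration of \<open>N\<close>, and call a real \<open>N'\<close> of type \<open>(-1, -1)\<close> in the Lie algebra \<^emph>\<open>good\<close> if it has
  the same weight filtration. Everything follows from one infinitesimal statement (\<open>ad_surjective\<close>): for every good \<open>N'\<close>
  the map \<open>A \<mapsto> [A, N']\<close> sends the real part of type \<open>(0, 0)\<close> onto the real part of type \<open>(-1, -1)\<close>. By an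
  open mapping theorem the orbit of \<open>N'\<close> under \<open>M\<close> then contains a neighbourhood of \<open>N'\<close>
  (\<open>conjugation_orbit_neighbourhood\<close>). Elements of \<open>M\<close> are products of exponentials that preserve the bigrading, so they
  preserve \<open>W\<close>, and the orbit of a good element consists of good elements. Hence the set of good elements is
  partitioned into orbits that are open, and that are connected because every element of \<open>M\<close> can be joined to the
  identity by shrinking the exponents. So the orbits are the connected components.

  The surjectivity is usually read off from an \<open>sl\<^sub>2\<close>-triple. Here it comes from a trace argument
  (\<open>lowering_in_range_ad\<close>). An endomorphism \<open>Z\<close> is in the image of \<open>ad N\<close> on \<open>gl(V)\<close> as soon as \<open>tr(B Z) = 0\<close> for all \<open>B\<close>
  commuting with \<open>N\<close>. Such a \<open>B\<close> preserves \<open>W\<close>, because \<open>W\<close> is given by the formula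
  \<open>W\<^sub>k = \<Sum>\<^sub>j N\<^sup>j ker N\<^sup>k\<^sup>+\<^sup>2\<^sup>j\<^sup>+\<^sup>1\<close>; so if \<open>Z\<close> lowers \<open>W\<close>, then so does \<open>B Z\<close>, which is therefore nilpotent and traceless. A solution
  \<open>A\<close> of \<open>[A, N] = Z\<close> in \<open>gl(V)\<close> is moved into the Lie algebra by averaging with minus its \<open>Q\<close>-adjoint, and then into type \<open>(0, 0)\<close>
  by projection. The projection stays real since the bigrading is split, and it stays in the Lie algebra since
  \<open>V\<^sup>p\<^sup>,\<^sup>q\<close> pairs under \<open>Q\<close> only with \<open>V\<^sup>w\<^sup>-\<^sup>p\<^sup>,\<^sup>w\<^sup>-\<^sup>q\<close>. The latter is where the isotropy of \<open>F\<close> and of \<open>W\<close> enters.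

  The formula for \<open>W\<close> also yields existence and uniqueness of the weight filtration and its isotropy under \<open>Q\<close>.
\<close>

section \<open>Powers of matrices\<close>

lemma mat_pow_simps [simp]:
  "mat_pow A 0 = mat 1" "mat_pow A (Suc k) = A ** mat_pow A k"
  by (simp_all add: mat_pow_def)

lemma mat_pow_add: "mat_pow A (m + n) = mat_pow A m ** mat_pow A n"
  by (induction m) (simp_all add: matrix_mul_assoc)

lemma mat_pow_vector_add: "mat_pow A m *v (mat_pow A n *v x) = mat_pow A (m + n) *v x"
  by (simp add: mat_pow_add matrix_vector_mul_assoc)

lemma mat_pow_vector_Suc: "A *v (mat_pow A n *v x) = mat_pow A (Suc n) *v x"
  by (simp add: matrix_vector_mul_assoc)

lemma mat_pow_zero_mono:
  assumes "mat_pow A m *v x = 0" "m \<le> n"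
  shows "mat_pow A n *v x = 0"
proof -
  have "mat_pow A n *v x = mat_pow A (n - m) *v (mat_pow A m *v x)"
    using assms(2) by (simp add: mat_pow_vector_add)
  then show ?thesis using assms(1) by simp
qed

lemma mat_pow_commute:
  assumes "B ** A = A ** B"
  shows "B ** mat_pow A k = mat_pow A k ** B"
proof (induction k)
  case (Suc k)
  have "B ** mat_pow A (Suc k) = A ** (B ** mat_pow A k)"
    using assms by (simp add: matrix_mul_assoc)
  then show ?case by (simp add: Suc matrix_mul_assoc)
qed simp

section \<open>The weight filtration of a nilpotent endomorphism\<close>

text \<open>
  A closed formula for the monodromy weight filtration: a Jordan string of length \<open>n + 1\<close> carries the weights
  \<open>n, n - 2, \<dots>, -n\<close>, and \<open>N\<^sup>j y\<close> with \<open>N\<^sup>n\<^sup>+\<^sup>1 y = 0\<close> has weight at most \<open>n - 2 j\<close>. The formula needs no choice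
  of a Jordan basis or of an \<open>sl\<^sub>2\<close>-triple. For \<open>k + 2 j + 1 \<le> 0\<close> the truncation by \<open>nat\<close> makes
  the kernel zero, as it should be.
\<close>

definition kernel_filtration :: "real^'n^'n \<Rightarrow> int \<Rightarrow> (real^'n) set" where
  "kernel_filtration N k =
     span (\<Union>j. (*v) (mat_pow N j) ` {y. mat_pow N (nat (k + 2 * int j + 1)) *v y = 0})"

lemma kernel_filtration_generator:
  assumes "mat_pow N (nat (k + 2 * int j + 1)) *v y = 0"
  shows "mat_pow N j *v y \<in> kernel_filtration N k"
  unfolding kernel_filtration_def using assms by (intro span_base) auto

lemma subspace_kernel_filtration [simp]: "subspace (kernel_filtration N k)"
  by (simp add: kernel_filtration_def)

lemma kernel_filtration_induct [consumes 1, case_names generator subspace]: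
  assumes "x \<in> kernel_filtration N k"
    and "\<And>j y. mat_pow N (nat (k + 2 * int j + 1)) *v y = 0 \<Longrightarrow> P (mat_pow N j *v y)"
    and "subspace {x. P x}"
  shows "P x"
proof -
  have "kernel_filtration N k \<subseteq> {x. P x}"
    unfolding kernel_filtration_def using assms(2,3) by (intro span_minimal) auto
  then show ?thesis using assms(1) by auto
qed

lemma subspace_matrix_preimage:
  fixes A :: "real^'n^'m"
  shows "subspace S \<Longrightarrow> subspace {x. A *v x \<in> S}"
  by (auto simp: subspace_def matrix_vector_right_distrib matrix_vector_mult_scaleR)

lemma subspace_matrix_image:
  fixes A :: "real^'n^'m"
  shows "subspace S \<Longrightarrow> subspace ((*v) A ` S)"
  by (simp add: linear_subspace_image)

lemma kernel_filtration_shift: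
  assumes "x \<in> kernel_filtration N k"
  shows "N *v x \<in> kernel_filtration N (k - 2)"
  using assms
proof (induction rule: kernel_filtration_induct)
  case (generator j y)
  then have "mat_pow N (Suc j) *v y \<in> kernel_filtration N (k - 2)"
    by (intro kernel_filtration_generator) (simp add: algebra_simps)
  then show ?case by (simp add: matrix_vector_mul_assoc)
qed (simp add: subspace_matrix_preimage)

lemma kernel_filtration_mono:
  assumes "k \<le> l" shows "kernel_filtration N k \<subseteq> kernel_filtration N l"
proof
  fix x assume "x \<in> kernel_filtration N k"
  then show "x \<in> kernel_filtration N l"
  proof (induction rule: kernel_filtration_induct)
    case (generator j y)
    show ?case
      by (rule kernel_filtration_generator, rule mat_pow_zero_mono[OF generator]) (use assms in simp)
  qed simp
qed

text \<open>Only the terms with \<open>j \<ge> k\<close> survive in degree \<open>-k\<close>, because for \<open>j < k\<close> the exponent of the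
  kernel is at most \<open>j\<close>.\<close>

lemma kernel_filtration_negative:
  assumes "x \<in> kernel_filtration N (- int k)"
  shows "\<exists>u \<in> kernel_filtration N (int k). x = mat_pow N k *v u"
proof -
  have "x \<in> (*v) (mat_pow N k) ` kernel_filtration N (int k)"
    using assms
  proof (induction rule: kernel_filtration_induct)
    case (generator j y)
    show ?case
    proof (cases "j \<ge> k")
      case True
      have "mat_pow N (j - k) *v y \<in> kernel_filtration N (int k)"
        by (rule kernel_filtration_generator, rule mat_pow_zero_mono[OF generator])
          (use True in simp)
      moreover have "mat_pow N j *v y = mat_pow N k *v (mat_pow N (j - k) *v y)"
        using True by (simp add: mat_pow_vector_add)
      ultimately show ?thesis by blast
    next
      case False
      have "mat_pow N j *v y = 0"
        by (rule mat_pow_zero_mono[OF generator]) (use False in simp)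
      moreover have "mat_pow N k *v 0 = 0" "0 \<in> kernel_filtration N (int k)"
        by (simp_all add: subspace_0)
      ultimately show ?thesis by (metis image_eqI)
    qed
  qed (simp add: subspace_matrix_image)
  then show ?thesis by auto
qed

text \<open>
  Surjectivity of \<open>N\<^sup>k\<close> on graded pieces holds even before passing to the quotient, by the previous lemma. For
  injectivity, if \<open>N\<^sup>k x\<close> lies in degree \<open>-k - 1\<close> then the same lemma gives \<open>N\<^sup>k x = N\<^sup>k\<^sup>+\<^sup>1 z\<close> with \<open>z\<close> in degree
  \<open>k + 1\<close>, so that \<open>x - N z\<close> is killed by \<open>N\<^sup>k\<close> and hence has degree \<open>k - 1\<close>, as does \<open>N z\<close>.
\<close>

theorem is_weight_filtration_kernel_filtration:
  assumes "mat_nilpotent N"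
  shows "is_weight_filtration N (kernel_filtration N)"
proof -
  obtain m where m: "mat_pow N m = 0"
    using assms by (auto simp: mat_nilpotent_def)
  then have kill: "mat_pow N n *v y = 0" if "n \<ge> m" for n y
    using mat_pow_zero_mono[of N m y n] that by simp
  have "kernel_filtration N (int m) = UNIV"
    using kernel_filtration_generator[of N "int m" 0] by (auto simp: kill)
  moreover have "kernel_filtration N (- 2 * int m) = {0}"
  proof -
    have "x = 0" if "x \<in> kernel_filtration N (- 2 * int m)" for x
      using that
    proof (induction rule: kernel_filtration_induct)
      case (generator j y)
      show ?case
        by (cases "j \<ge> m") (use generator in \<open>simp_all add: kill\<close>)
    qed (simp add: subspace_def)
    then show ?thesis by (auto simp: subspace_0)
  qed
  ultimately have "increasing_filtration (kernel_filtration N)"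
    unfolding increasing_filtration_def mono_def using kernel_filtration_mono
    by (metis subspace_kernel_filtration)
  moreover have "x \<in> kernel_filtration N (int k - 1)"
    if "mat_pow N k *v x \<in> kernel_filtration N (- int k - 1)" for k x
  proof -
    have "- int (Suc k) = - int k - 1" by simp
    then have "mat_pow N k *v x \<in> kernel_filtration N (- int (Suc k))"
      using that by metis
    then obtain z where z: "z \<in> kernel_filtration N (int (Suc k))"
        "mat_pow N k *v x = mat_pow N (Suc k) *v z"
      using kernel_filtration_negative by blast
    have "mat_pow N k *v (x - N *v z) = 0"
      using z(2) mat_pow_vector_add[of N k 1 z]
      by (simp add: matrix_vector_mult_diff_distrib)
    then have "x - N *v z \<in> kernel_filtration N (int k - 1)"
      using kernel_filtration_generator[of N "int k - 1" 0 "x - N *v z"] by simp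
    moreover have "N *v z \<in> kernel_filtration N (int k - 1)"
      using kernel_filtration_shift[OF z(1)] by simp
    ultimately show ?thesis
      using subspace_add[OF subspace_kernel_filtration] by fastforce
  qed
  moreover have "\<exists>x \<in> kernel_filtration N (int k).
      y - mat_pow N k *v x \<in> kernel_filtration N (- int k - 1)"
    if "y \<in> kernel_filtration N (- int k)" for k y
    using kernel_filtration_negative[OF that] by (force simp: subspace_0)
  ultimately show ?thesis
    unfolding is_weight_filtration_def using kernel_filtration_shift by blast
qed

lemma weight_filtration_iterate_shift:
  assumes "is_weight_filtration N W" "x \<in> W k"
  shows "mat_pow N j *v x \<in> W (k - 2 * int j)"
proof (induction j)
  case (Suc j)
  then have "N *v (mat_pow N j *v x) \<in> W (k - 2 * int j - 2)"
    using assms(1) unfolding is_weight_filtration_def by blast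
  then show ?case by (simp add: mat_pow_vector_Suc algebra_simps del: mat_pow_simps(2))
qed (use assms in simp)

text \<open>
  The point is that \<open>N\<^sup>i\<^sup>+\<^sup>1 y = 0\<close> forces \<open>y \<in> W\<^sub>i\<close>: as long as \<open>y \<in> W\<^sub>l\<close> with \<open>l > i\<close>, injectivity of \<open>N\<^sup>l\<close> on the
  graded piece pushes \<open>y\<close> into \<open>W\<^sub>l\<^sub>-\<^sub>1\<close>.
\<close>

lemma kernel_filtration_le_weight_filtration:
  assumes W: "is_weight_filtration N W"
  shows "kernel_filtration N k \<subseteq> W k"
proof
  have sub: "subspace (W l)" and mono: "mono W" for l
    using W unfolding is_weight_filtration_def increasing_filtration_def by auto
  obtain t where t: "W t = UNIV"
    using W unfolding is_weight_filtration_def increasing_filtration_def by auto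
  have ker: "y \<in> W (int i)" if y: "mat_pow N (Suc i) *v y = 0" for i y
  proof -
    have "y \<in> W (int (i + d))" if "y \<in> W (int (i + e))" "d \<le> e" for d e
      using that
    proof (induction e)
      case (Suc e)
      show ?case
      proof (cases "d = Suc e")
        case False
        have "mat_pow N (i + Suc e) *v y = 0"
          by (rule mat_pow_zero_mono[OF y]) simp
        then have "mat_pow N (i + Suc e) *v y \<in> W (- int (i + Suc e) - 1)"
          using sub by (simp add: subspace_0)
        then have "y \<in> W (int (i + Suc e) - 1)"
          using W Suc.prems(1) unfolding is_weight_filtration_def by blast
        then show ?thesis using Suc False by simp
      qed (use Suc in simp)
    qed simp
    moreover have "y \<in> W (int (i + nat t))"
      using monoD[OF mono, of t "int (i + nat t)"] t 
      by (metis UNIV_I subsetD int_nat_eq le_add2 nat_le_iff order_trans of_nat_add nat_int)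
    ultimately show ?thesis by (metis add.right_neutral le0)
  qed
  fix x assume "x \<in> kernel_filtration N k"
  then show "x \<in> W k"
  proof (induction rule: kernel_filtration_induct)
    case (generator j y)
    show ?case
    proof (cases "k + 2 * int j \<ge> 0")
      case True
      then have "nat (k + 2 * int j + 1) = Suc (nat (k + 2 * int j))" by simp
      then have "y \<in> W (k + 2 * int j)"
        using ker[of "nat (k + 2 * int j)" y] generator True by simp
      then show ?thesis
        using weight_filtration_iterate_shift[OF W, of y "k + 2 * int j" j] by simp
    next
      case False
      then have "y = 0" using generator by simp
      then show ?thesis using sub by (simp add: subspace_0)
    qed
  qed (simp add: sub)
qed

text \<open>Surjectivity onto the graded pieces of degree \<open>-k, -k-1, \<dots>\<close> writes an element of \<open>W\<^sub>-\<^sub>k\<close> as a sum of terms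
  \<open>N\<^sup>i u\<close> with \<open>i \<ge> k\<close> and \<open>u \<in> W\<^sub>i\<close>.\<close>

lemma weight_filtration_negative:
  assumes W: "is_weight_filtration N W"
    and top: "\<And>i. k \<le> i \<Longrightarrow> W (int i) \<subseteq> kernel_filtration N (int i)"
    and x: "x \<in> W (- int k)"
  shows "\<exists>u \<in> kernel_filtration N (int k). x = mat_pow N k *v u"
proof -
  obtain b where b: "W b = {0}" and mono: "mono W"
    using W unfolding is_weight_filtration_def increasing_filtration_def by auto
  define d where "d = nat (- b)"
  have "\<exists>u \<in> kernel_filtration N (int i). x = mat_pow N i *v u"
    if "k \<le> i" "i \<le> k + d" "x \<in> W (- int i)" for i x
    using that(2,1,3)
  proof (induction i arbitrary: x rule: inc_induct)
    case base
    \<comment> \<open>The descent stops where the filtration is zero.\<close>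
    have "W (- int (k + d)) \<subseteq> W b" by (rule monoD[OF mono]) (simp add: d_def)
    then have "x = 0" using base b by auto
    then show ?case by (intro bexI[of _ 0]) (simp_all add: subspace_0)
  next
    case (step i)
    obtain u where u: "u \<in> W (int i)" "x - mat_pow N i *v u \<in> W (- int i - 1)"
      using W step.prems(2) unfolding is_weight_filtration_def by blast
    moreover have "- int (Suc i) = - int i - 1" by simp
    ultimately have "x - mat_pow N i *v u \<in> W (- int (Suc i))" by metis
    then obtain v where v: "v \<in> kernel_filtration N (int (Suc i))"
        "x - mat_pow N i *v u = mat_pow N (Suc i) *v v"
      using step.IH step.prems(1) by (meson le_SucI)
    have "mat_pow N (Suc i) *v v = mat_pow N i *v (N *v v)"
      using mat_pow_vector_add[of N i 1 v] by simp
    then have "x = mat_pow N i *v (u + N *v v)"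
      using v(2) by (simp add: matrix_vector_right_distrib algebra_simps)
    moreover have "N *v v \<in> kernel_filtration N (int i)"
      using kernel_filtration_shift[OF v(1)] kernel_filtration_mono[of "int (Suc i) - 2" "int i" N]
      by auto
    then have "u + N *v v \<in> kernel_filtration N (int i)"
      using u(1) top[OF step.prems(1)] by (intro subspace_add) auto
    ultimately show ?case by blast
  qed
  then show ?thesis using x by (metis le_add1 order_refl)
qed

text \<open>
  It remains to bound \<open>W\<^sub>k\<close> from above. For \<open>k \<ge> 0\<close> this is a downward induction: \<open>N\<^sup>k\<^sup>+\<^sup>1 x\<close> lies in \<open>W\<^sub>-\<^sub>k\<^sub>-\<^sub>2\<close>, so
  the previous lemma writes it as \<open>N\<^sup>k\<^sup>+\<^sup>2 u\<close> with \<open>u\<close> of degree \<open>k + 2\<close>, and \<open>x - N u\<close> is killed by \<open>N\<^sup>k\<^sup>+\<^sup>1\<close>. Negative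
  degrees are then images of positive ones.
\<close>

theorem weight_filtration_unique:
  assumes W: "is_weight_filtration N W"
  shows "W = kernel_filtration N"
proof -
  obtain t where t: "W t = UNIV" and mono: "mono W"
    using W unfolding is_weight_filtration_def increasing_filtration_def by auto
  have E: "is_weight_filtration N (kernel_filtration N)"
  proof (rule is_weight_filtration_kernel_filtration)
    obtain b where b: "W b = {0}"
      using W unfolding is_weight_filtration_def increasing_filtration_def by auto
    have "mat_pow N (nat (t - b)) *v x = 0" for x
    proof -
      have "mat_pow N (nat (t - b)) *v x \<in> W (t - 2 * int (nat (t - b)))"
        using weight_filtration_iterate_shift[OF W, of x t] t by blast
      moreover have "W (t - 2 * int (nat (t - b))) \<subseteq> W b"
        by (rule monoD[OF mono]) linarith
      ultimately show ?thesis using b by auto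
    qed
    then show "mat_nilpotent N"
      unfolding mat_nilpotent_def by (metis matrix_eq matrix_vector_mult_0)
  qed
  obtain t' where t': "kernel_filtration N t' = UNIV"
    using E unfolding is_weight_filtration_def increasing_filtration_def by auto
  have nonneg: "\<forall>j\<ge>i. W (int j) \<subseteq> kernel_filtration N (int j)" if "i \<le> nat t'" for i
    using that
  proof (induction i rule: inc_induct)
    case base
    then show ?case
      using kernel_filtration_mono[of t' _ N] t' by (metis UNIV_I nat_le_iff subsetD subsetI)
  next
    case (step i)
    have "x \<in> kernel_filtration N (int i)" if x: "x \<in> W (int i)" for x
    proof -
      have "mat_pow N (Suc i) *v x \<in> W (- int (Suc (Suc i)))"
        using weight_filtration_iterate_shift[OF W x, of "Suc i"] by (simp add: algebra_simps)
      then obtain u where u: "u \<in> kernel_filtration N (int (Suc (Suc i)))"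
          "mat_pow N (Suc i) *v x = mat_pow N (Suc (Suc i)) *v u"
        using weight_filtration_negative[OF W, of "Suc (Suc i)"] step.IH
        by (metis Suc_leD)
      have "mat_pow N (Suc i) *v (x - N *v u) = 0"
        using u(2) mat_pow_vector_add[of N "Suc i" 1 u]
        by (simp add: matrix_vector_mult_diff_distrib)
      then have "x - N *v u \<in> kernel_filtration N (int i)"
        using kernel_filtration_generator[of N "int i" 0 "x - N *v u"] by (simp add: nat_add_distrib)
      moreover have "N *v u \<in> kernel_filtration N (int i)"
        using kernel_filtration_shift[OF u(1)] by simp
      ultimately show ?thesis
        using subspace_add[OF subspace_kernel_filtration] by fastforce
    qed
    then show ?case using step.IH by (metis le_antisym not_less_eq_eq subsetI)
  qed
  have nonneg0: "W (int j) \<subseteq> kernel_filtration N (int j)" for j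
    using nonneg[of 0] by blast
  have "W k \<subseteq> kernel_filtration N k" for k
  proof (cases "k \<ge> 0")
    case True
    then show ?thesis using nonneg0 by (metis nonneg_int_cases)
  next
    case False
    then obtain m where m: "k = - int m" by (metis int_cases2 of_nat_0_le_iff)
    have "x \<in> kernel_filtration N k" if "x \<in> W k" for x
    proof -
      obtain u where "u \<in> kernel_filtration N (int m)" "x = mat_pow N m *v u"
        using weight_filtration_negative[OF W nonneg0, of x m] \<open>x \<in> W k\<close> m by blast
      then show ?thesis
        using weight_filtration_iterate_shift[OF E, of u "int m" m] m by simp
    qed
    then show ?thesis by blast
  qed
  then show ?thesis
    using kernel_filtration_le_weight_filtration[OF W] by (intro ext equalityI)
qed

corollary weight_filtration_eq_kernel_filtration:
  assumes "mat_nilpotent N"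
  shows "weight_filtration N = kernel_filtration N"
  unfolding weight_filtration_def
  using is_weight_filtration_kernel_filtration[OF assms] weight_filtration_unique
  by (rule the_equality)

text \<open>
  The centralizer of \<open>N\<close> in \<open>gl(V)\<close> has only non-positive weights; here this is immediate because the filtration is
  built from kernels and images of powers of \<open>N\<close>.
\<close>

lemma kernel_filtration_commute:
  assumes "B ** N = N ** B" "x \<in> kernel_filtration N k"
  shows "B *v x \<in> kernel_filtration N k"
  using assms(2)
proof (induction rule: kernel_filtration_induct)
  case (generator j y)
  have comm: "mat_pow N i *v (B *v z) = B *v (mat_pow N i *v z)" for i z
    using mat_pow_commute[OF assms(1), of i] by (simp add: matrix_vector_mul_assoc)
  have "mat_pow N (nat (k + 2 * int j + 1)) *v (B *v y) = 0"
    by (simp add: comm generator)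
  then show ?case
    using kernel_filtration_generator comm by metis
qed (simp add: subspace_matrix_preimage)

text \<open>
  Since \<open>N\<close> is skew, its powers can be moved to either side of \<open>Q\<close>. For generators \<open>N\<^sup>a y\<close> and \<open>N\<^sup>b z\<close> the power
  \<open>N\<^sup>a\<^sup>+\<^sup>b\<close> kills \<open>y\<close> or \<open>z\<close>, because otherwise \<open>b - a \<le> k\<close> and \<open>a - b \<le> l\<close>.
\<close>

lemma kernel_filtration_orthogonal:
  fixes Q :: "real^'n \<Rightarrow> real^'n \<Rightarrow> real"
  assumes Q: "bilinear Q" and N: "N \<in> lie_g_real Q"
    and u: "u \<in> kernel_filtration N k" and v: "v \<in> kernel_filtration N l" and kl: "k + l < 0"
  shows "Q u v = 0"
proof -
  have subl: "subspace {x. Q x y = 0}" and subr: "subspace {x. Q y x = 0}" for y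
    using Q by (simp_all add: subspace_def bilinear_ladd bilinear_radd bilinear_lzero bilinear_rzero
        bilinear_lmul bilinear_rmul)
  have skew: "Q (N *v x) y = - Q x (N *v y)" for x y
    using N unfolding lie_g_real_def by (simp add: eq_neg_iff_add_eq_0)
  have skew_pow: "Q (mat_pow N i *v x) y = (-1) ^ i * Q x (mat_pow N i *v y)" for i x y
  proof (induction i arbitrary: y)
    case (Suc i)
    have "mat_pow N i *v (N *v y) = mat_pow N (Suc i) *v y"
      using mat_pow_vector_add[of N i 1 y] by simp
    then show ?case
      by (simp add: skew Suc flip: matrix_vector_mul_assoc)
  qed simp
  show ?thesis
    using u
  proof (induction rule: kernel_filtration_induct)
    case (generator a y)
    show ?case
      using v
    proof (induction rule: kernel_filtration_induct)
      case (generator b z)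
      note y = \<open>mat_pow N (nat (k + 2 * int a + 1)) *v y = 0\<close>
      note z = \<open>mat_pow N (nat (l + 2 * int b + 1)) *v z = 0\<close>
      consider "k + 2 * int a + 1 \<le> int (a + b)" | "l + 2 * int b + 1 \<le> int (a + b)"
        using kl by linarith
      then show ?case
      proof cases
        case 1
        then have "mat_pow N (b + a) *v y = 0"
          by (intro mat_pow_zero_mono[OF y]) linarith
        moreover have "Q (mat_pow N a *v y) (mat_pow N b *v z) =
            (-1) ^ b * Q (mat_pow N (b + a) *v y) z"
          using skew_pow[of b "mat_pow N a *v y" z]
          by (simp add: mat_pow_vector_add mult.assoc[symmetric] power_mult_distrib[symmetric])
        ultimately show ?thesis using Q by (simp add: bilinear_lzero)
      next
        case 2
        then have "mat_pow N (a + b) *v z = 0"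
          by (intro mat_pow_zero_mono[OF z]) linarith
        then show ?thesis
          using Q by (simp add: skew_pow mat_pow_vector_add bilinear_rzero)
      qed
    qed (rule subr)
  qed (rule subl)
qed

section \<open>The image of \<open>ad N\<close>\<close>

interpretation matrix_mult: bounded_bilinear
  "(**) :: real^'n^'m \<Rightarrow> real^'p^'n \<Rightarrow> real^'p^'m"
proof -
  have "bilinear ((**) :: real^'n^'m \<Rightarrow> real^'p^'n \<Rightarrow> real^'p^'m)"
    unfolding bilinear_def
    by (auto intro!: linearI simp: vec_eq_iff matrix_matrix_mult_def algebra_simps sum.distrib
        sum_distrib_left)
  then show "bounded_bilinear ((**) :: real^'n^'m \<Rightarrow> real^'p^'n \<Rightarrow> real^'p^'m)"
    by (simp add: bilinear_conv_bounded_bilinear)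
qed

lemma trace_eq_sum_orthonormal_basis:
  fixes T :: "real^'n^'n"
  assumes B: "pairwise orthogonal B" "\<And>b. b \<in> B \<Longrightarrow> norm b = 1" "finite B" "span B = UNIV"
  shows "trace T = (\<Sum>b\<in>B. b \<bullet> (T *v b))"
proof -
  have expand: "(\<Sum>b\<in>B. (x \<bullet> b) *\<^sub>R b) = x" for x
    using orthonormal_basis_expand[OF B(1,2)] B(3,4) by blast
  have "T $ i $ i = (\<Sum>b\<in>B. b $ i * (T *v b) $ i)" for i
  proof -
    have "T $ i $ i = (T *v axis i 1) $ i"
      using matrix_vector_mult_basis[of T i] by (simp add: column_def)
    also have "\<dots> = (T *v (\<Sum>b\<in>B. (axis i 1 \<bullet> b) *\<^sub>R b)) $ i"
      by (simp add: expand)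
    also have "\<dots> = (\<Sum>b\<in>B. b $ i * (T *v b) $ i)"
      by (simp add: linear_sum[OF matrix_vector_mul_linear] matrix_vector_mult_scaleR
          inner_axis' sum_component)
    finally show ?thesis .
  qed
  then have "trace T = (\<Sum>i\<in>UNIV. \<Sum>b\<in>B. b $ i * (T *v b) $ i)"
    by (simp add: trace_def)
  also have "\<dots> = (\<Sum>b\<in>B. b \<bullet> (T *v b))"
    by (subst sum.swap) (simp add: inner_vec_def)
  finally show ?thesis .
qed

text \<open>
  Choose an orthonormal basis adapted to the flag \<open>W\<close>: a basis vector that is new in \<open>W\<^sub>k\<^sub>+\<^sub>1\<close> is orthogonal to
  \<open>W\<^sub>k\<close>, which contains its image, so all diagonal entries of \<open>T\<close> vanish.
\<close>

lemma trace_eq_0_if_lowers_filtration: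
  fixes T :: "real^'n^'n"
  assumes W: "increasing_filtration W" and T: "\<And>k x. x \<in> W k \<Longrightarrow> T *v x \<in> W (k - 1)"
  shows "trace T = 0"
proof -
  obtain b t where b: "W b = {0}" and t: "W t = UNIV" and sub: "subspace (W k)"
      and mono: "mono W" for k
    using W unfolding increasing_filtration_def by auto
  \<comment> \<open>An orthonormal basis of \<open>W k\<close> in which \<open>T\<close> has zero diagonal.\<close>
  define adapted where "adapted k B \<longleftrightarrow> pairwise orthogonal B \<and> (\<forall>x\<in>B. norm x = 1) \<and> finite B \<and>
      span B = W k \<and> (\<forall>x\<in>B. x \<bullet> (T *v x) = 0)" for k B
  have "\<exists>B. adapted k B" if "b \<le> k" for k
    using that
  proof (induction k rule: int_ge_induct)
    case base
    show ?case using b by (intro exI[of _ "{}"]) (simp add: adapted_def)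
  next
    case (step k)
    obtain B where B: "adapted k B" using step.IH by blast
    have subC: "subspace {x \<in> W (k + 1). \<forall>y \<in> W k. orthogonal x y}"
      using sub[of "k + 1"] by (auto simp: subspace_def orthogonal_def inner_left_distrib)
    obtain C where C: "C \<subseteq> {x \<in> W (k + 1). \<forall>y \<in> W k. orthogonal x y}" "pairwise orthogonal C"
        "\<And>x. x \<in> C \<Longrightarrow> norm x = 1" "independent C"
        "card C = dim {x \<in> W (k + 1). \<forall>y \<in> W k. orthogonal x y}"
        "span C = {x \<in> W (k + 1). \<forall>y \<in> W k. orthogonal x y}"
      by (rule orthonormal_basis_subspace[OF subC], rule that)
    have le: "W k \<subseteq> W (k + 1)" by (rule monoD[OF mono]) simp
    have BW: "B \<subseteq> W k" using B span_superset unfolding adapted_def by auto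
    have "pairwise orthogonal (B \<union> C)"
    proof -
      have "orthogonal x y" "orthogonal y x" if "x \<in> B" "y \<in> C" for x y
        using that C(1) BW orthogonal_commute by blast+
      then show ?thesis
        using B C(2) unfolding adapted_def pairwise_def by blast
    qed
    moreover have "span (B \<union> C) = W (k + 1)"
    proof
      show "span (B \<union> C) \<subseteq> W (k + 1)"
        using BW le C(1) sub by (intro span_minimal) auto
      show "W (k + 1) \<subseteq> span (B \<union> C)"
      proof
        fix x assume x: "x \<in> W (k + 1)"
        obtain y z where yz: "y \<in> span (W k)" "\<And>w. w \<in> span (W k) \<Longrightarrow> orthogonal z w" "x = y + z"
          by (rule orthogonal_subspace_decomp_exists[of "W k" x], rule that)
        have y: "y \<in> W k" using yz(1) sub by (metis span_eq_iff)
        have "z = x - y" using yz(3) by simp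
        then have "z \<in> W (k + 1)" using x y le sub by (auto intro: subspace_diff)
        then have "z \<in> span C" using C(6) yz(2) by (auto intro: span_base)
        moreover have "y \<in> span B" using B y by (simp add: adapted_def)
        ultimately show "x \<in> span (B \<union> C)"
          unfolding yz(3) by (meson span_add span_mono subsetD sup_ge1 sup_ge2)
      qed
    qed
    moreover have "x \<bullet> (T *v x) = 0" if "x \<in> C" for x
      using T[of x "k + 1"] C(1) that by (auto simp: orthogonal_def)
    ultimately have "adapted (k + 1) (B \<union> C)"
      using B C(3,4) independent_imp_finite[OF C(4)] unfolding adapted_def by blast
    then show ?case by blast
  qed
  moreover have "W (max b t) = UNIV"
    using monoD[OF mono, of t "max b t"] t by auto
  ultimately obtain B where "adapted (max b t) B" "W (max b t) = UNIV"
    by (metis max.cobounded1)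
  then show ?thesis
    using trace_eq_sum_orthonormal_basis[of B T] by (simp add: adapted_def)
qed

lemma matrix_inner_eq_trace:
  fixes A B :: "real^'n^'m"
  shows "A \<bullet> B = trace (transpose A ** B)"
  unfolding inner_vec_def trace_def matrix_matrix_mult_def transpose_def
  by (simp, subst sum.swap) simp

text \<open>
  With respect to the trace form, the orthogonal complement of the image of \<open>ad N\<close> is the centralizer of \<open>N\<close>.
\<close>

lemma in_range_ad_if_trace_zero:
  fixes N Z :: "real^'n^'n"
  assumes "\<And>B. B ** N = N ** B \<Longrightarrow> trace (B ** Z) = 0"
  shows "\<exists>A. A ** N - N ** A = Z"
proof -
  let ?L = "\<lambda>A. A ** N - N ** A"
  have "linear ?L"
    by (rule linearI) (simp_all add: matrix_mult.add_left matrix_mult.add_right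
        matrix_mult.scaleR_left matrix_mult.scaleR_right scaleR_diff_right)
  then have sub: "subspace (range ?L)"
    by (simp add: linear_subspace_image)
  obtain Y C where YC: "Y \<in> span (range ?L)" "\<And>X. X \<in> span (range ?L) \<Longrightarrow> orthogonal C X" "Z = Y + C"
    by (rule orthogonal_subspace_decomp_exists[of "range ?L" Z], rule that)
  define B where "B = transpose C"
  have "trace ((N ** B - B ** N) ** A) = 0" for A
  proof -
    have "0 = trace (B ** (A ** N - N ** A))"
      using YC(2)[of "?L A"] by (simp add: orthogonal_def matrix_inner_eq_trace B_def span_base)
    also have "\<dots> = trace (B ** A ** N) - trace (B ** N ** A)"
      by (simp add: matrix_mult.diff_right trace_sub matrix_mul_assoc)
    also have "trace (B ** A ** N) = trace (N ** B ** A)"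
      by (metis trace_mul_sym matrix_mul_assoc)
    finally show ?thesis by (simp add: matrix_mult.diff_left trace_sub)
  qed
  then have "(transpose (N ** B - B ** N)) \<bullet> A = 0" for A
    by (simp add: matrix_inner_eq_trace)
  then have "transpose (N ** B - B ** N) = 0"
    using inner_eq_zero_iff by blast
  then have "B ** N = N ** B"
    by (simp add: transpose_def vec_eq_iff)
  then have "C \<bullet> Z = 0"
    using assms[of B] by (simp add: matrix_inner_eq_trace B_def)
  moreover have "C \<bullet> Y = 0" using YC(1,2) by (simp add: orthogonal_def)
  ultimately have "C = 0" by (simp add: YC(3) inner_add_right)
  moreover have "Y \<in> range ?L" using YC(1) sub by (simp only: span_eq_iff[THEN iffD2])
  ultimately show ?thesis using YC(3) by auto
qed

text \<open>
  This replaces the representation theory of \<open>sl\<^sub>2\<close>: an endomorphism of negative weight lies in the image of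
  \<open>ad N\<close>, since its product with anything that commutes with \<open>N\<close> still has negative weight and so is traceless.
\<close>

proposition lowering_in_range_ad:
  fixes N Z :: "real^'n^'n"
  assumes N: "mat_nilpotent N"
    and Z: "\<And>k x. x \<in> weight_filtration N k \<Longrightarrow> Z *v x \<in> weight_filtration N (k - 1)"
  shows "\<exists>A. A ** N - N ** A = Z"
proof (rule in_range_ad_if_trace_zero)
  fix B assume B: "B ** N = N ** B"
  show "trace (B ** Z) = 0"
  proof (rule trace_eq_0_if_lowers_filtration)
    show "increasing_filtration (weight_filtration N)"
      using is_weight_filtration_kernel_filtration[OF N]
      by (simp add: weight_filtration_eq_kernel_filtration[OF N] is_weight_filtration_def)
    show "(B ** Z) *v x \<in> weight_filtration N (k - 1)" if "x \<in> weight_filtration N k" for k x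
      using kernel_filtration_commute[OF B] Z[OF that]
      by (simp add: weight_filtration_eq_kernel_filtration[OF N] flip: matrix_vector_mul_assoc)
  qed
qed

section \<open>Complexification of subspaces, endomorphisms and forms\<close>

lemma cmat_cvec [simp]: "cmat A *v cvec x = cvec (A *v x)"
  by (simp add: cmat_def cvec_def vec_eq_iff matrix_vector_mult_def)

lemma cmat_mult: "cmat (A ** B) = cmat A ** cmat B"
  by (simp add: cmat_def vec_eq_iff matrix_matrix_mult_def)

lemma cmat_diff: "cmat (A - B) = cmat A - cmat B"
  and cmat_one [simp]: "cmat (mat 1) = mat 1"
  by (simp_all add: cmat_def vec_eq_iff mat_def)

lemma cmat_eq_iff [simp]: "cmat A = cmat B \<longleftrightarrow> A = B"
  by (simp add: cmat_def vec_eq_iff)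

lemma conj_vec_simps [simp]:
  "conj_vec (u + v) = conj_vec u + conj_vec v"
  "conj_vec (c *s v) = cnj c *s conj_vec v"
  "conj_vec 0 = 0"
  "conj_vec (conj_vec v) = v"
  "conj_vec (cmat A *v v) = cmat A *v conj_vec v"
  by (simp_all add: conj_vec_def cmat_def vec_eq_iff matrix_vector_mult_def)

lemma conj_vec_eq_0_iff [simp]: "conj_vec v = 0 \<longleftrightarrow> v = 0"
  by (metis conj_vec_simps(3,4))

definition re_vec :: "complex^'n \<Rightarrow> real^'n" where "re_vec v = (\<chi> i. Re (v $ i))"
definition im_vec :: "complex^'n \<Rightarrow> real^'n" where "im_vec v = (\<chi> i. Im (v $ i))"

lemma complex_vec_decompose: "v = cvec (re_vec v) + \<i> *s cvec (im_vec v)"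
  by (simp add: vec_eq_iff cvec_def re_vec_def im_vec_def complex_eq_iff)

lemma cvec_in_complexify_iff:
  assumes "subspace W"
  shows "cvec x \<in> complexify W \<longleftrightarrow> x \<in> W"
proof
  have "vec.subspace {v. re_vec v \<in> W \<and> im_vec v \<in> W}"
    unfolding vec.subspace_def
  proof (intro conjI ballI allI)
    show "0 \<in> {v. re_vec v \<in> W \<and> im_vec v \<in> W}"
      using subspace_0[OF assms] by (simp add: re_vec_def im_vec_def zero_vec_def)
  next
    fix u v assume "u \<in> {v. re_vec v \<in> W \<and> im_vec v \<in> W}" "v \<in> {v. re_vec v \<in> W \<and> im_vec v \<in> W}"
    moreover have "re_vec (u + v) = re_vec u + re_vec v" "im_vec (u + v) = im_vec u + im_vec v"
      by (simp_all add: re_vec_def im_vec_def vec_eq_iff)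
    ultimately show "u + v \<in> {v. re_vec v \<in> W \<and> im_vec v \<in> W}"
      using subspace_add[OF assms] by auto
  next
    fix c v assume "v \<in> {v. re_vec v \<in> W \<and> im_vec v \<in> W}"
    moreover have "re_vec (c *s v) = Re c *\<^sub>R re_vec v - Im c *\<^sub>R im_vec v"
      "im_vec (c *s v) = Re c *\<^sub>R im_vec v + Im c *\<^sub>R re_vec v"
      by (simp_all add: re_vec_def im_vec_def vec_eq_iff)
    ultimately show "c *s v \<in> {v. re_vec v \<in> W \<and> im_vec v \<in> W}"
      using subspace_add[OF assms] subspace_diff[OF assms] subspace_scale[OF assms] by auto
  qed
  moreover have "cvec ` W \<subseteq> {v. re_vec v \<in> W \<and> im_vec v \<in> W}"
    using subspace_0[OF assms] by (auto simp: cvec_def re_vec_def im_vec_def zero_vec_def)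
  moreover assume "cvec x \<in> complexify W"
  ultimately have "cvec x \<in> {v. re_vec v \<in> W \<and> im_vec v \<in> W}"
    unfolding complexify_def using vec.span_minimal by blast
  then show "x \<in> W" by (simp add: cvec_def re_vec_def)
qed (simp add: complexify_def vec.span_base)

lemma complex_subspace_preimage:
  fixes A :: "complex^'n^'m"
  assumes "vec.subspace S"
  shows "vec.subspace {v. A *v v \<in> S}"
  using assms by (simp add: vec.subspace_def matrix_vector_right_distrib vector_scalar_commute)

lemma cmat_complexify:
  assumes "\<And>x. x \<in> W \<Longrightarrow> A *v x \<in> W'" "v \<in> complexify W"
  shows "cmat A *v v \<in> complexify W'"
proof -
  have "complexify W \<subseteq> {v. cmat A *v v \<in> complexify W'}"
    unfolding complexify_def[of W]
  proof (rule vec.span_minimal)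
    show "cvec ` W \<subseteq> {v. cmat A *v v \<in> complexify W'}"
      using assms(1) by (auto simp: complexify_def intro: vec.span_base)
    show "vec.subspace {v. cmat A *v v \<in> complexify W'}"
      by (rule complex_subspace_preimage) (simp add: complexify_def)
  qed
  then show ?thesis using assms(2) by blast
qed

lemma cmat_complexify_iff:
  assumes "subspace W'"
  shows "(\<forall>v \<in> complexify W. cmat A *v v \<in> complexify W') \<longleftrightarrow> (\<forall>x \<in> W. A *v x \<in> W')"
proof
  assume *: "\<forall>v \<in> complexify W. cmat A *v v \<in> complexify W'"
  show "\<forall>x \<in> W. A *v x \<in> W'"
  proof
    fix x assume "x \<in> W"
    then have "cvec x \<in> complexify W" by (simp add: complexify_def vec.span_base)
    then have "cvec (A *v x) \<in> complexify W'" using * by force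
    then show "A *v x \<in> W'" by (simp add: cvec_in_complexify_iff[OF assms])
  qed
qed (use cmat_complexify in blast)

lemma complex_form_simps [simp]:
  "complex_form Q (u + u') v = complex_form Q u v + complex_form Q u' v"
  "complex_form Q u (v + v') = complex_form Q u v + complex_form Q u v'"
  "complex_form Q (c *s u) v = c * complex_form Q u v"
  "complex_form Q u (c *s v) = c * complex_form Q u v"
  "complex_form Q 0 v = 0"
  "complex_form Q u 0 = 0"
  by (simp_all add: complex_form_def algebra_simps sum.distrib sum_distrib_left)

lemma cnj_complex_form: "cnj (complex_form Q u v) = complex_form Q (conj_vec u) (conj_vec v)"
  by (simp add: complex_form_def conj_vec_def)

lemma complex_form_cvec:
  assumes "bilinear Q"
  shows "complex_form Q (cvec x) (cvec y) = complex_of_real (Q x y)"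
proof -
  have "Q x y = Q (\<Sum>i\<in>UNIV. x $ i *\<^sub>R axis i 1) (\<Sum>j\<in>UNIV. y $ j *\<^sub>R axis j 1)"
    using basis_expansion[of x] basis_expansion[of y] by (simp add: scalar_mult_eq_scaleR)
  also have "\<dots> = (\<Sum>(i, j)\<in>UNIV \<times> UNIV. Q (x $ i *\<^sub>R axis i 1) (y $ j *\<^sub>R axis j 1))"
    by (rule bilinear_sum[OF assms])
  also have "\<dots> = (\<Sum>i\<in>UNIV. \<Sum>j\<in>UNIV. x $ i * y $ j * Q (axis i 1) (axis j 1))"
    using assms by (simp add: sum.cartesian_product bilinear_lmul bilinear_rmul mult.assoc)
  finally show ?thesis
    by (simp add: complex_form_def cvec_def)
qed

lemma complex_form_complexify_eq_0:
  assumes Q: "bilinear Q" and zero: "\<And>x y. x \<in> W \<Longrightarrow> y \<in> W' \<Longrightarrow> Q x y = 0"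
    and u: "u \<in> complexify W" and v: "v \<in> complexify W'"
  shows "complex_form Q u v = 0"
proof -
  have "cvec ` W' \<subseteq> {v. \<forall>x\<in>W. complex_form Q (cvec x) v = 0}"
    using zero by (auto simp: complex_form_cvec[OF Q])
  then have "complexify W' \<subseteq> {v. \<forall>x\<in>W. complex_form Q (cvec x) v = 0}"
    unfolding complexify_def by (rule vec.span_minimal) (simp add: vec.subspace_def)
  then have "cvec ` W \<subseteq> {u. complex_form Q u v = 0}"
    using v by auto
  then have "complexify W \<subseteq> {u. complex_form Q u v = 0}"
    unfolding complexify_def by (rule vec.span_minimal) (simp add: vec.subspace_def)
  then show ?thesis using u by blast
qed

lemma cmat_in_lie_g_complex_iff:
  assumes Q: "bilinear Q"
  shows "cmat X \<in> lie_g_complex Q \<longleftrightarrow> X \<in> lie_g_real Q"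
proof
  assume "cmat X \<in> lie_g_complex Q"
  then have "complex_of_real (Q (X *v x) y + Q x (X *v y)) = 0" for x y
    unfolding lie_g_complex_def using complex_form_cvec[OF Q] cmat_cvec
    by (metis (mono_tags, lifting) mem_Collect_eq of_real_add)
  then show "X \<in> lie_g_real Q"
    by (simp add: lie_g_real_def del: of_real_add)
next
  assume X: "X \<in> lie_g_real Q"
  then have real: "complex_form Q (cvec (X *v x)) (cvec y) + complex_form Q (cvec x) (cvec (X *v y)) = 0"
    for x y
    by (simp add: complex_form_cvec[OF Q] lie_g_real_def flip: of_real_add)
  have "complex_form Q (cmat X *v u) v + complex_form Q u (cmat X *v v) = 0" for u v
  proof -
    define a b c d where "a = re_vec u" "b = im_vec u" "c = re_vec v" "d = im_vec v"
    have u: "u = cvec a + \<i> *s cvec b" and v: "v = cvec c + \<i> *s cvec d"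
      by (simp_all add: a_b_c_d_def complex_vec_decompose[symmetric])
    have "complex_form Q (cmat X *v u) v + complex_form Q u (cmat X *v v) =
      (complex_form Q (cvec (X *v a)) (cvec c) + complex_form Q (cvec a) (cvec (X *v c))) +
      \<i> * (complex_form Q (cvec (X *v b)) (cvec c) + complex_form Q (cvec b) (cvec (X *v c))) +
      \<i> * (complex_form Q (cvec (X *v a)) (cvec d) + complex_form Q (cvec a) (cvec (X *v d))) +
      \<i> * \<i> * (complex_form Q (cvec (X *v b)) (cvec d) + complex_form Q (cvec b) (cvec (X *v d)))"
      unfolding u v
      by (simp add: matrix_vector_right_distrib vector_scalar_commute algebra_simps)
    then show ?thesis by (simp only: real) simp
  qed
  then show "cmat X \<in> lie_g_complex Q" by (simp add: lie_g_complex_def)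
qed

text \<open>
  A complex matrix that commutes with conjugation has real entries: apply it to the standard basis.
\<close>

lemma real_matrixI:
  fixes D :: "complex^'n^'n"
  assumes "\<And>v. conj_vec (D *v v) = D *v conj_vec v"
  shows "\<exists>A. D = cmat A"
proof -
  have "cnj (D $ i $ j) = D $ i $ j" for i j
  proof -
    have "conj_vec (axis j 1) = (axis j 1 :: complex^'n)"
      by (simp add: conj_vec_def axis_def vec_eq_iff)
    moreover have "(D *v axis j 1) $ i = D $ i $ j"
      by (simp add: matrix_vector_mult_def axis_def if_distrib cong: if_cong)
    ultimately show ?thesis
      using assms[of "axis j 1"] by (metis conj_vec_def vec_lambda_beta)
  qed
  then have "D = cmat (map_matrix Re D)"
    by (simp add: vec_eq_iff cmat_def complex_eq_iff)
  then show ?thesis by blast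
qed

section \<open>Adjoints with respect to \<open>Q\<close>\<close>

text \<open>
  Nondegeneracy makes \<open>y \<mapsto> Q(-, y)\<close> an isomorphism \<open>T\<close> onto the dual, identified with \<open>V\<close> by the inner product;
  the adjoint is \<open>T\<^sup>-\<^sup>1\<close> composed with the transpose of \<open>A\<close> and \<open>T\<close>.
\<close>

lemma adjoint_matrix_exists:
  fixes Q :: "real^'n \<Rightarrow> real^'n \<Rightarrow> real" and A :: "real^'n^'n"
  assumes Q: "bilinear Q" and nondeg: "\<And>y. (\<And>x. Q x y = 0) \<Longrightarrow> y = 0"
  shows "\<exists>A'. \<forall>x y. Q (A *v x) y = Q x (A' *v y)"
proof -
  have expand: "f x = x \<bullet> (\<chi> i. f (axis i 1))" if "linear f" for f :: "real^'n \<Rightarrow> real" and x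
  proof -
    have "f x = f (\<Sum>i\<in>UNIV. x $ i *\<^sub>R axis i 1)"
      using basis_expansion[of x] by (simp add: scalar_mult_eq_scaleR)
    then show ?thesis
      using that by (simp add: linear_sum linear_scale inner_vec_def)
  qed
  define T where "T y = (\<chi> i. Q (axis i 1) y)" for y
  have T: "Q x y = x \<bullet> T y" for x y
    unfolding T_def by (rule expand[of "\<lambda>x. Q x y"]) (use Q in \<open>simp add: bilinear_def\<close>)
  have linT: "linear T"
    unfolding T_def using Q
    by (intro linearI) (simp_all add: vec_eq_iff bilinear_radd bilinear_rmul)
  have "inj T"
    unfolding linear_injective_0[OF linT] using nondeg T by auto
  then obtain S where S: "linear S" "\<And>y. T (S y) = y"
    using linear_injective_isomorphism[OF linT] by metis
  define A' where "A' = matrix (\<lambda>y. S (transpose A *v T y))"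
  have "linear (\<lambda>y. S (transpose A *v T y))"
    using linear_compose[OF linear_compose[OF linT matrix_vector_mul_linear[of "transpose A"]] S(1)]
    by (simp add: o_def del: transpose_matrix_vector)
  then have "A' *v y = S (transpose A *v T y)" for y
    unfolding A'_def by (rule matrix_vector_mul(2)[THEN fun_cong])
  then have "Q (A *v x) y = Q x (A' *v y)" for x y
    using dot_lmul_matrix[of "T y" A x] by (simp add: T S inner_commute)
  then show ?thesis by blast
qed

text \<open>
  The map \<open>A \<mapsto> -A'\<close>, where \<open>A'\<close> is the \<open>Q\<close>-adjoint, is an involution of \<open>gl(V)\<close> that preserves brackets and fixes
  \<open>N\<close> and \<open>Z\<close>. So \<open>-A'\<close> is a second solution, and the average of the two is skew.
\<close>

lemma skew_preimage_ad:
  fixes Q :: "real^'n \<Rightarrow> real^'n \<Rightarrow> real"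
  assumes Q: "bilinear Q" and sym: "\<And>x y. Q y x = \<epsilon> * Q x y"
    and nondeg: "\<And>x. (\<And>y. Q x y = 0) \<Longrightarrow> x = 0"
    and N: "N \<in> lie_g_real Q" and Z: "Z \<in> lie_g_real Q" and A: "A ** N - N ** A = Z"
  shows "\<exists>A \<in> lie_g_real Q. A ** N - N ** A = Z"
proof -
  have nondeg': "y = 0" if "\<And>x. Q x y = 0" for y
    using nondeg sym that by (metis mult_zero_right)
  obtain A' where A': "\<And>x y. Q (A *v x) y = Q x (A' *v y)"
    using adjoint_matrix_exists[OF Q nondeg'] by blast
  have A'': "Q (A' *v x) y = Q x (A *v y)" for x y
    by (metis A' sym)
  have skew: "Q (N *v x) y = - Q x (N *v y)" "Q (Z *v x) y = - Q x (Z *v y)" for x y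
    using N Z unfolding lie_g_real_def by (simp_all add: eq_neg_iff_add_eq_0)
  have "(A' ** N - N ** A') *v y = - (Z *v y)" for y
  proof -
    have "Q x ((A' ** N - N ** A') *v y + Z *v y) = 0" for x
    proof -
      have "Q x ((A' ** N - N ** A') *v y) = Q x (A' *v (N *v y)) - Q x (N *v (A' *v y))"
        using Q by (simp add: matrix_vector_mult_diff_rdistrib bilinear_rsub
            matrix_vector_mul_assoc)
      also have "\<dots> = Q (A *v x) (N *v y) + Q (N *v x) (A' *v y)"
        by (simp add: A' skew)
      also have "\<dots> = - Q (N *v (A *v x)) y + Q (A *v (N *v x)) y"
        by (simp add: A' skew)
      also have "\<dots> = Q ((A ** N - N ** A) *v x) y"
        using Q by (simp add: matrix_vector_mult_diff_rdistrib bilinear_lsub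
            matrix_vector_mul_assoc)
      also have "\<dots> = - Q x (Z *v y)"
        by (simp add: A skew)
      finally show ?thesis using Q by (simp add: bilinear_radd)
    qed
    then show ?thesis using nondeg' eq_neg_iff_add_eq_0 by blast
  qed
  then have "A' ** N - N ** A' = - Z"
    by (simp add: matrix_eq) (simp add: matrix_vector_mult_def vec_eq_iff sum_negf)
  moreover have "((1/2) *\<^sub>R (A - A')) ** N - N ** ((1/2) *\<^sub>R (A - A')) =
      (1/2) *\<^sub>R ((A ** N - N ** A) - (A' ** N - N ** A'))"
    by (simp add: matrix_mult.scaleR_left matrix_mult.scaleR_right matrix_mult.diff_left
        matrix_mult.diff_right scaleR_diff_right)
  ultimately have "((1/2) *\<^sub>R (A - A')) ** N - N ** ((1/2) *\<^sub>R (A - A')) = Z"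
    by (simp add: A flip: scaleR_2)
  moreover have "(1/2) *\<^sub>R (A - A') \<in> lie_g_real Q"
    using Q by (simp add: lie_g_real_def scaleR_matrix_vector_assoc[symmetric]
        matrix_vector_mult_diff_rdistrib bilinear_lmul bilinear_rmul bilinear_lsub bilinear_rsub
 A' A'')
      (simp add: field_simps)
  ultimately show ?thesis by blast
qed

section \<open>Projections of a bigrading and components of type \<open>(0, 0)\<close>\<close>

lemma sum_matrix_vector_mult:
  "(\<Sum>x\<in>S. A x) *v v = (\<Sum>x\<in>S. A x *v v)" for A :: "'b \<Rightarrow> 'a::semiring_1^'n^'m"
  by (induction S rule: infinite_finite_induct) (simp_all add: matrix_vector_mult_add_rdistrib)

text \<open>
  A bigrading together with the projections onto its pieces, encoded as matrices so that they can be multiplied with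
  endomorphisms; \<open>S\<close> is a finite set of indices outside of which all pieces vanish.
\<close>

locale projected_bigrading =
  fixes V :: "int \<Rightarrow> int \<Rightarrow> (complex^'n) set" and S :: "(int \<times> int) set"
    and P :: "int \<Rightarrow> int \<Rightarrow> complex^'n^'n"
  assumes finite_support: "finite S"
    and subspace_piece: "\<And>p q. vec.subspace (V p q)"
    and proj_in: "\<And>p q v. P p q *v v \<in> V p q"
    and proj_piece: "\<And>p q r s v. v \<in> V p q \<Longrightarrow> P r s *v v = (if r = p \<and> s = q then v else 0)"
    and sum_proj: "\<And>v. (\<Sum>(p, q)\<in>S. P p q *v v) = v"
begin

lemma bigrading_induct:
  assumes "\<And>p q v. v \<in> V p q \<Longrightarrow> \<Phi> v" "\<Phi> 0" "\<And>u v. \<Phi> u \<Longrightarrow> \<Phi> v \<Longrightarrow> \<Phi> (u + v)"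
  shows "\<Phi> v"
proof -
  have "\<Phi> (\<Sum>(p, q)\<in>T. P p q *v v)" if "finite T" for T
    using that by (induction T) (auto intro: assms(3) assms(1)[OF proj_in] simp: assms(2))
  then show ?thesis using finite_support sum_proj by metis
qed

lemma matrix_eqI:
  fixes A B :: "complex^'n^'m"
  assumes "\<And>p q v. v \<in> V p q \<Longrightarrow> A *v v = B *v v"
  shows "A = B"
proof -
  have "A *v v = B *v v" for v
    by (rule bigrading_induct[of "\<lambda>v. A *v v = B *v v"])
      (use assms in \<open>simp_all add: matrix_vector_right_distrib\<close>)
  then show ?thesis by (simp add: matrix_eq)
qed

lemma span_pieces_iff:
  "v \<in> vec.span (\<Union>{V r s | r s. R r s}) \<longleftrightarrow> (\<forall>r s. \<not> R r s \<longrightarrow> P r s *v v = 0)"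
proof
  have "\<Union>{V r s | r s. R r s} \<subseteq> {v. \<forall>r s. \<not> R r s \<longrightarrow> P r s *v v = 0}"
    by (auto simp: proj_piece)
  moreover have "vec.subspace {v. \<forall>r s. \<not> R r s \<longrightarrow> P r s *v v = 0}"
    by (simp add: vec.subspace_def matrix_vector_right_distrib vector_scalar_commute)
  moreover assume "v \<in> vec.span (\<Union>{V r s | r s. R r s})"
  ultimately show "\<forall>r s. \<not> R r s \<longrightarrow> P r s *v v = 0"
    using vec.span_minimal by blast
next
  assume zero: "\<forall>r s. \<not> R r s \<longrightarrow> P r s *v v = 0"
  have "(\<Sum>(p, q)\<in>S. P p q *v v) \<in> vec.span (\<Union>{V r s | r s. R r s})"
  proof (rule vec.span_sum, clarify)
    fix p q
    show "P p q *v v \<in> vec.span (\<Union>{V r s | r s. R r s})"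
    proof (cases "R p q")
      case True
      then show ?thesis using proj_in[of p q v] by (intro vec.span_base) blast
    qed (simp add: zero vec.span_zero)
  qed
  then show "v \<in> vec.span (\<Union>{V r s | r s. R r s})" by (simp only: sum_proj)
qed

lemma in_pieceI:
  assumes "\<And>r s. \<not> (r = p \<and> s = q) \<Longrightarrow> P r s *v v = 0"
  shows "v \<in> V p q"
proof -
  have "v \<in> vec.span (\<Union>{V r s | r s. r = p \<and> s = q})"
    using assms by (subst span_pieces_iff) blast
  moreover have "\<Union>{V r s | r s. r = p \<and> s = q} = V p q" by blast
  ultimately show ?thesis by (simp add: vec.span_eq_iff[THEN iffD2] subspace_piece)
qed

text \<open>
  Conjugation exchanges the pieces of types \<open>(p, q)\<close> and \<open>(q, p)\<close>, hence also the projections onto them.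
\<close>

lemma proj_conj:
  assumes "split_over_reals V"
  shows "P q p *v conj_vec v = conj_vec (P p q *v v)"
proof (rule bigrading_induct[of "\<lambda>v. P q p *v conj_vec v = conj_vec (P p q *v v)"])
  fix r s v assume v: "v \<in> V r s"
  then have "conj_vec v \<in> V s r" using assms by (auto simp: split_over_reals_def)
  then show "P q p *v conj_vec v = conj_vec (P p q *v v)" using v by (auto simp: proj_piece)
qed (simp_all add: matrix_vector_right_distrib)

text \<open>
  The component of type \<open>(0, 0)\<close> of an endomorphism.
\<close>

definition diagonal_part :: "complex^'n^'n \<Rightarrow> complex^'n^'n" where
  "diagonal_part A = (\<Sum>(p, q)\<in>S. P p q ** A ** P p q)"

lemma diagonal_part_piece:
  assumes v: "v \<in> V p q"
  shows "diagonal_part A *v v = P p q *v (A *v v)"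
proof -
  have eq: "P r s ** A ** P r s *v v = (if (r, s) = (p, q) then P p q *v (A *v v) else 0)" for r s
    using proj_piece[OF v] by (auto simp flip: matrix_vector_mul_assoc)
  have "diagonal_part A *v v = (\<Sum>x\<in>S. if x = (p, q) then P p q *v (A *v v) else 0)"
    unfolding diagonal_part_def sum_matrix_vector_mult by (rule sum.cong) (auto simp: eq split: if_splits)
  also have "\<dots> = P p q *v (A *v v)"
  proof (cases "(p, q) \<in> S")
    case False
    have "v = (\<Sum>x\<in>S. if x = (p, q) then v else 0)"
      by (subst sum_proj[symmetric], rule sum.cong) (auto simp: proj_piece[OF v] split: if_splits)
    then have "v = 0" using False finite_support by simp
    then show ?thesis using finite_support by simp
  qed (use finite_support in simp)
  finally show ?thesis .
qed

lemma diagonal_part_real: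
  assumes split: "split_over_reals V"
  shows "\<exists>B. diagonal_part (cmat A) = cmat B"
proof (rule real_matrixI)
  fix v
  show "conj_vec (diagonal_part (cmat A) *v v) = diagonal_part (cmat A) *v conj_vec v"
  proof (rule bigrading_induct[of "\<lambda>v. conj_vec (diagonal_part (cmat A) *v v) =
        diagonal_part (cmat A) *v conj_vec v"])
    fix p q v assume v: "v \<in> V p q"
    then have "conj_vec v \<in> V q p" using split by (auto simp: split_over_reals_def)
    then show "conj_vec (diagonal_part (cmat A) *v v) = diagonal_part (cmat A) *v conj_vec v"
      using v by (simp add: diagonal_part_piece proj_conj[OF split, symmetric])
  qed (simp_all add: matrix_vector_right_distrib)
qed

text \<open>
  The piece of type \<open>(p, q)\<close> pairs only with the one of type \<open>(w - p, w - q)\<close>. So the pairing of \<open>A u\<close> with such a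
  piece sees only one component of \<open>A u\<close>, and skewness of \<open>A\<close> passes to its diagonal part.
\<close>

lemma diagonal_part_skew:
  assumes orth: "\<And>p q r s u v. u \<in> V p q \<Longrightarrow> v \<in> V r s \<Longrightarrow> \<not> (p + r = w \<and> q + s = w)
      \<Longrightarrow> complex_form Q u v = 0"
    and A: "A \<in> lie_g_complex Q"
  shows "diagonal_part A \<in> lie_g_complex Q"
proof -
  \<comment> \<open>Replacing \<open>u\<close> by its component dual to \<open>v\<close> does not change the pairing with \<open>v\<close>.\<close>
  have pick_left: "complex_form Q (P (w - r) (w - s) *v u) v = complex_form Q u v"
    if v: "v \<in> V r s" for r s u v
  proof (rule bigrading_induct[of "\<lambda>u. complex_form Q (P (w - r) (w - s) *v u) v = complex_form Q u v"])
    fix p q u assume u: "u \<in> V p q"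
    show "complex_form Q (P (w - r) (w - s) *v u) v = complex_form Q u v"
      using orth[OF u v] by (auto simp: proj_piece[OF u])
  qed (simp_all add: matrix_vector_right_distrib)
  have pick_right: "complex_form Q u (P (w - p) (w - q) *v v) = complex_form Q u v"
    if u: "u \<in> V p q" for p q u v
  proof (rule bigrading_induct[of "\<lambda>v. complex_form Q u (P (w - p) (w - q) *v v) = complex_form Q u v"])
    fix r s v assume v: "v \<in> V r s"
    show "complex_form Q u (P (w - p) (w - q) *v v) = complex_form Q u v"
      using orth[OF u v] by (auto simp: proj_piece[OF v])
  qed (simp_all add: matrix_vector_right_distrib)
  let ?D = "diagonal_part A"
  have piece: "complex_form Q (?D *v u) v + complex_form Q u (?D *v v) = 0"
    if u: "u \<in> V p q" and v: "v \<in> V r s" for p q r s u v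
  proof (cases "p + r = w \<and> q + s = w")
    case True
    then have "p = w - r" "q = w - s" "r = w - p" "s = w - q" by auto
    then have "complex_form Q (?D *v u) v + complex_form Q u (?D *v v) =
        complex_form Q (A *v u) v + complex_form Q u (A *v v)"
      using pick_left[OF v] pick_right[OF u] diagonal_part_piece[OF u] diagonal_part_piece[OF v]
      by metis
    then show ?thesis using A by (simp add: lie_g_complex_def)
  next
    case False
    then show ?thesis
      using orth[OF proj_in v] orth[OF u proj_in] u v by (simp add: diagonal_part_piece)
  qed
  have "complex_form Q (?D *v u) v + complex_form Q u (?D *v v) = 0" for u v
  proof (rule bigrading_induct[of "\<lambda>u. complex_form Q (?D *v u) v + complex_form Q u (?D *v v) = 0"])
    fix p q u assume u: "u \<in> V p q"
    show "complex_form Q (?D *v u) v + complex_form Q u (?D *v v) = 0"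
      by (rule bigrading_induct[of "\<lambda>v. complex_form Q (?D *v u) v + complex_form Q u (?D *v v) = 0"])
        (use piece[OF u] in \<open>simp_all add: matrix_vector_right_distrib algebra_simps
          add.assoc[symmetric] eq_neg_iff_add_eq_0\<close>)
  qed (simp_all add: matrix_vector_right_distrib algebra_simps)
  then show ?thesis by (simp add: lie_g_complex_def)
qed

text \<open>
  The projections onto the \<open>(0, 0)\<close> and \<open>(-1, -1)\<close> components intertwine \<open>ad N\<close>, because \<open>N\<close> is homogeneous of type
  \<open>(-1, -1)\<close>.
\<close>

lemma diagonal_part_bracket:
  assumes N: "\<And>p q v. v \<in> V p q \<Longrightarrow> N *v v \<in> V (p - 1) (q - 1)"
    and Z: "\<And>p q v. v \<in> V p q \<Longrightarrow> Z *v v \<in> V (p - 1) (q - 1)"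
    and A: "A ** N - N ** A = Z"
  shows "diagonal_part A ** N - N ** diagonal_part A = Z"
proof (rule matrix_eqI)
  fix p q v assume v: "v \<in> V p q"
  have N_proj: "N *v (P p q *v u) = P (p - 1) (q - 1) *v (N *v u)" for u
  proof (rule bigrading_induct[of "\<lambda>u. N *v (P p q *v u) = P (p - 1) (q - 1) *v (N *v u)"])
    fix r s u assume u: "u \<in> V r s"
    show "N *v (P p q *v u) = P (p - 1) (q - 1) *v (N *v u)"
      using proj_piece[OF u] proj_piece[OF N[OF u]] by simp
  qed (simp_all add: matrix_vector_right_distrib)
  have "(diagonal_part A ** N - N ** diagonal_part A) *v v =
      P (p - 1) (q - 1) *v (A *v (N *v v)) - N *v (P p q *v (A *v v))"
    using v N[OF v]
    by (simp add: matrix_vector_mult_diff_rdistrib diagonal_part_piece flip: matrix_vector_mul_assoc)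
  also have "\<dots> = P (p - 1) (q - 1) *v ((A ** N - N ** A) *v v)"
    by (simp add: N_proj matrix_vector_mult_diff_rdistrib matrix_vector_mult_diff_distrib
        flip: matrix_vector_mul_assoc)
  also have "\<dots> = Z *v v"
    using proj_piece[OF Z[OF v]] A by simp
  finally show "(diagonal_part A ** N - N ** diagonal_part A) *v v = Z *v v" .
qed

end

text \<open>
  The projections are obtained from the decompositions of the standard basis vectors. Uniqueness of decompositions shows
  that the resulting matrices do not depend on the basis, in particular that they act as expected on the pieces.
\<close>

lemma bigrading_projections:
  fixes V :: "int \<Rightarrow> int \<Rightarrow> (complex^'n) set"
  assumes V: "bigrading V"
  obtains S P where "projected_bigrading V S P"
proof -
  define decomposes where "decomposes v f \<longleftrightarrow>
      (\<forall>p q. f (p, q) \<in> V p q) \<and> finite {x. f x \<noteq> 0} \<and> v = (\<Sum>x | f x \<noteq> 0. f x)" for v f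
  have sub: "vec.subspace (V p q)" and ex1: "\<exists>!f. decomposes v f" for p q v
    using V unfolding bigrading_def decomposes_def by auto
  have decomposesI: "decomposes v f"
    if "\<And>p q. f (p, q) \<in> V p q" "finite T" "\<And>x. x \<notin> T \<Longrightarrow> f x = 0" "v = (\<Sum>x\<in>T. f x)" for v f T
  proof -
    have "{x. f x \<noteq> 0} \<subseteq> T" using that(3) by blast
    moreover have "(\<Sum>x | f x \<noteq> 0. f x) = (\<Sum>x\<in>T. f x)"
      by (rule sum.mono_neutral_left) (use that calculation in auto)
    ultimately show ?thesis
      using that finite_subset unfolding decomposes_def by metis
  qed
  define f where "f i = (THE f. decomposes (axis i 1) f)" for i
  have f: "decomposes (axis i 1) (f i)" for i
    unfolding f_def by (rule theI'[OF ex1])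
  define S where "S = (\<Union>i. {x. f i x \<noteq> 0})"
  define P where "P p q = (\<chi> j i. f i (p, q) $ j)" for p q
  have P: "P p q *v v = (\<Sum>i\<in>UNIV. v $ i *s f i (p, q))" for p q v
    by (simp add: P_def matrix_vector_mult_def vec_eq_iff mult.commute)
  have finS: "finite S" using f by (simp add: S_def decomposes_def)
  have outside: "P p q *v v = 0" if "(p, q) \<notin> S" for p q v
    using that by (simp add: P S_def)
  have PV: "P p q *v v \<in> V p q" for p q v
    unfolding P using f sub by (intro vec.subspace_sum vec.subspace_scale) (auto simp: decomposes_def)
  have total: "(\<Sum>(p, q)\<in>S. P p q *v v) = v" for v
  proof -
    have "(\<Sum>x\<in>S. f i x) = axis i 1" for i
    proof -
      have "(\<Sum>x | f i x \<noteq> 0. f i x) = (\<Sum>x\<in>S. f i x)"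
        by (rule sum.mono_neutral_left) (use finS in \<open>auto simp: S_def\<close>)
      then show ?thesis using f[of i] by (simp add: decomposes_def)
    qed
    moreover have "(\<Sum>(p, q)\<in>S. P p q *v v) = (\<Sum>i\<in>UNIV. v $ i *s (\<Sum>x\<in>S. f i x))"
      unfolding P by (simp add: case_prod_unfold vec.scale_sum_right) (rule sum.swap)
    ultimately show ?thesis by (simp add: basis_expansion)
  qed
  have piece: "P r s *v v = (if r = p \<and> s = q then v else 0)" if v: "v \<in> V p q" for p q r s v
  proof -
    have "decomposes v (\<lambda>(r, s). P r s *v v)"
      by (rule decomposesI[of _ S]) (use PV finS outside total in auto)
    moreover have "decomposes v (\<lambda>x. if x = (p, q) then v else 0)"
      by (rule decomposesI[of _ "{(p, q)}"]) (use v sub vec.subspace_0 in auto)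
    ultimately have "(\<lambda>(r, s). P r s *v v) = (\<lambda>x. if x = (p, q) then v else 0)"
      using ex1 by blast
    then show ?thesis by (auto dest: fun_cong[of _ _ "(r, s)"])
  qed
  have "projected_bigrading V S P"
    by unfold_locales (use finS sub PV piece total in auto)
  then show thesis by (rule that)
qed

section \<open>The exponential of a matrix\<close>

lemma mat_pow_scaleR: "mat_pow (c *\<^sub>R A) k = c ^ k *\<^sub>R mat_pow A k" for A :: "real^'n^'n"
  by (induction k) (simp_all add: matrix_mult.scaleR_left matrix_mult.scaleR_right)

lemma norm_mat_pow_le:
  obtains K where "K > 0" "\<And>(A :: real^'n^'n) k. norm (mat_pow A k) \<le> norm (mat 1 :: real^'n^'n) * (K * norm A) ^ k"
proof -
  obtain K where K: "K > 0" "\<And>(A :: real^'n^'n) (B :: real^'n^'n). norm (A ** B) \<le> norm A * norm B * K"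
    using matrix_mult.pos_bounded by blast
  have "norm (mat_pow A k) \<le> norm (mat 1 :: real^'n^'n) * (K * norm A) ^ k" for A :: "real^'n^'n" and k
  proof (induction k)
    case (Suc k)
    have "norm (mat_pow A (Suc k)) \<le> norm A * norm (mat_pow A k) * K"
      using K(2)[of A "mat_pow A k"] by simp
    also have "\<dots> \<le> norm A * (norm (mat 1 :: real^'n^'n) * (K * norm A) ^ k) * K"
      using Suc K(1) by (intro mult_right_mono mult_left_mono) auto
    finally show ?case by (simp add: mult_ac)
  qed simp
  then show thesis using K(1) that by blast
qed

text \<open>
  Power series in a matrix are treated in general because two of them are needed: \<open>exp(X)\<close> and \<open>(exp(X) - 1) / X\<close>,
  whose continuity at \<open>0\<close> gives the derivative of \<open>exp\<close> there.
\<close>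

definition mat_series :: "(nat \<Rightarrow> real) \<Rightarrow> real^'n^'n \<Rightarrow> real^'n^'n" where
  "mat_series c A = (\<Sum>k. c k *\<^sub>R mat_pow A k)"

lemma mat_exp_eq_mat_series: "mat_exp = mat_series (\<lambda>k. 1 / fact k)"
  by (simp add: fun_eq_iff mat_exp_def mat_series_def)

lemma mat_series_majorant:
  assumes c: "\<And>k. \<bar>c k\<bar> \<le> 1 / fact k" and r: "0 \<le> r"
  obtains m where "summable m"
    "\<And>(A :: real^'n^'n) k. norm A \<le> r \<Longrightarrow> norm (c k *\<^sub>R mat_pow A k) \<le> m k"
proof -
  obtain K where K: "K > 0"
    "\<And>(A :: real^'n^'n) k. norm (mat_pow A k) \<le> norm (mat 1 :: real^'n^'n) * (K * norm A) ^ k"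
    using norm_mat_pow_le by blast
  define m where "m k = norm (mat 1 :: real^'n^'n) * (inverse (fact k) * (K * r) ^ k)" for k
  have "summable m"
    unfolding m_def by (intro summable_mult summable_exp)
  moreover have "norm (c k *\<^sub>R mat_pow A k) \<le> m k" if "norm A \<le> r" for A :: "real^'n^'n" and k
  proof -
    have "norm (mat_pow A k) \<le> norm (mat 1 :: real^'n^'n) * (K * r) ^ k"
      using K(2)[of A k] that K(1) r
      by (smt (verit) mult_left_mono mult_nonneg_nonneg norm_ge_zero power_mono)
    then have "\<bar>c k\<bar> * norm (mat_pow A k) \<le> (1 / fact k) * (norm (mat 1 :: real^'n^'n) * (K * r) ^ k)"
      using c by (intro mult_mono) auto
    then show ?thesis by (simp add: m_def field_simps)
  qed
  ultimately show thesis by (rule that)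
qed

lemma summable_mat_series:
  fixes A :: "real^'n^'n"
  assumes c: "\<And>k. \<bar>c k\<bar> \<le> 1 / fact k"
  shows "summable (\<lambda>k. c k *\<^sub>R mat_pow A k)"
proof -
  obtain m where "summable m" "\<And>(B :: real^'n^'n) k. norm B \<le> norm A \<Longrightarrow> norm (c k *\<^sub>R mat_pow B k) \<le> m k"
    using mat_series_majorant[OF c norm_ge_zero] by metis
  then show ?thesis by (blast intro: summable_comparison_test)
qed

lemma continuous_on_mat_series:
  assumes c: "\<And>k. \<bar>c k\<bar> \<le> 1 / fact k"
  shows "continuous_on UNIV (mat_series c :: real^'n^'n \<Rightarrow> real^'n^'n)"
proof -
  have "isCont (mat_series c) A" for A :: "real^'n^'n"
  proof -
    obtain m where m: "summable m"
      "\<And>(B :: real^'n^'n) k. norm B \<le> norm A + 1 \<Longrightarrow> norm (c k *\<^sub>R mat_pow B k) \<le> m k"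
      using mat_series_majorant[of c "norm A + 1", OF c] by (metis add_nonneg_nonneg norm_ge_zero zero_le_one)
    have pow: "continuous_on UNIV (\<lambda>B :: real^'n^'n. mat_pow B k)" for k
      by (induction k) (auto intro!: continuous_intros matrix_mult.continuous_on)
    have "uniform_limit (ball A 1) (\<lambda>n B. \<Sum>k<n. c k *\<^sub>R mat_pow B k) (mat_series c) sequentially"
      unfolding mat_series_def
    proof (rule Weierstrass_m_test[OF _ m(1)])
      fix k B assume "B \<in> ball A 1"
      then have "norm B \<le> norm A + 1"
        using norm_triangle_sub[of B A] by (simp add: dist_norm norm_minus_commute)
      then show "norm (c k *\<^sub>R mat_pow B k) \<le> m k" by (rule m(2))
    qed
    from uniform_limit_theorem[OF _ this]
    have "continuous_on (ball A 1) (mat_series c)"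
      if "\<forall>\<^sub>F n in sequentially. continuous_on (ball A 1) (\<lambda>B. \<Sum>k<n. c k *\<^sub>R mat_pow B k)"
      using that by simp
    moreover have "\<forall>\<^sub>F n in sequentially. continuous_on (ball A 1) (\<lambda>B. \<Sum>k<n. c k *\<^sub>R mat_pow B k)"
      by (intro always_eventually allI continuous_intros continuous_on_subset[OF pow]) auto
    ultimately have "continuous_on (ball A 1) (mat_series c)" by blast
    then show ?thesis
      by (simp add: continuous_on_eq_continuous_at)
  qed
  then show ?thesis by (simp add: continuous_at_imp_continuous_on)
qed

lemma continuous_on_mat_exp [continuous_intros]:
  fixes f :: "'a::topological_space \<Rightarrow> real^'n^'n"
  assumes "continuous_on S f"
  shows "continuous_on S (\<lambda>x. mat_exp (f x))"
  using continuous_on_compose2[OF continuous_on_mat_series assms]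
  unfolding mat_exp_eq_mat_series by auto

lemma mat_series_0 [simp]: "mat_series c 0 = c 0 *\<^sub>R (mat 1 :: real^'n^'n)"
proof -
  have "mat_pow (0 :: real^'n^'n) k = 0" if "k \<noteq> 0" for k
    using that by (cases k) (simp_all add: matrix_mult.zero_left)
  then show ?thesis
    unfolding mat_series_def by (subst suminf_finite[of "{0}"]) auto
qed

lemma mat_exp_0 [simp]: "mat_exp 0 = (mat 1 :: real^'n^'n)"
  by (simp add: mat_exp_eq_mat_series)

lemma mat_exp_expand:
  fixes X :: "real^'n^'n"
  shows "mat_exp X = mat 1 + X ** mat_series (\<lambda>k. 1 / fact (Suc k)) X"
proof -
  have c: "\<bar>1 / fact (Suc k)\<bar> \<le> 1 / (fact k :: real)" for k
    by (simp add: frac_le fact_mono del: fact_Suc)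
  have "(\<Sum>k. (1 / fact (Suc k)) *\<^sub>R mat_pow X (Suc k)) = mat_exp X - mat 1"
    using suminf_split_head[OF summable_mat_series[of "\<lambda>k. 1 / fact k" X]]
    by (simp add: mat_exp_def del: mat_pow_simps(2))
  moreover have "X ** mat_series (\<lambda>k. 1 / fact (Suc k)) X =
      (\<Sum>k. X ** ((1 / fact (Suc k)) *\<^sub>R mat_pow X k))"
    unfolding mat_series_def
    by (rule bounded_linear.suminf[OF matrix_mult.bounded_linear_right summable_mat_series[OF c]])
  ultimately show ?thesis
    by (simp add: matrix_mult.scaleR_right algebra_simps)
qed

lemma mat_exp_has_derivative_at_0: "(mat_exp has_derivative (\<lambda>X. X)) (at (0 :: real^'n^'n))"
proof -
  define \<phi> where "\<phi> = (mat_series (\<lambda>k. 1 / fact (Suc k)) :: real^'n^'n \<Rightarrow> real^'n^'n)"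
  have c: "\<bar>1 / fact (Suc k)\<bar> \<le> 1 / (fact k :: real)" for k
    by (simp add: frac_le fact_mono del: fact_Suc)
  obtain K where K: "K > 0" "\<And>(A :: real^'n^'n) (B :: real^'n^'n). norm (A ** B) \<le> norm A * norm B * K"
    using matrix_mult.pos_bounded by blast
  have "continuous_on UNIV \<phi>"
    unfolding \<phi>_def by (rule continuous_on_mat_series[OF c])
  then have "isCont \<phi> 0"
    by (simp add: continuous_on_eq_continuous_at)
  then have "(\<phi> \<longlongrightarrow> mat 1) (at 0)"
    by (simp add: isCont_def \<phi>_def)
  then have lim: "((\<lambda>X. norm (\<phi> X - mat 1) * K) \<longlongrightarrow> 0) (at 0)"
    by (auto intro!: tendsto_eq_intros)
  show ?thesis
  proof (rule has_derivativeI_sandwich[OF zero_less_one bounded_linear_ident _ lim])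
    fix X :: "real^'n^'n" assume "X \<noteq> 0"
    have "mat_exp X - mat_exp 0 - (X - 0) = X ** (\<phi> X - mat 1)"
      by (simp add: mat_exp_expand[of X] \<phi>_def matrix_mult.diff_right)
    then have "norm (mat_exp X - mat_exp 0 - (X - 0)) \<le> norm X * norm (\<phi> X - mat 1) * K"
      using K(2) by simp
    then show "norm (mat_exp X - mat_exp 0 - (X - 0)) / norm (X - 0) \<le> norm (\<phi> X - mat 1) * K"
      using \<open>X \<noteq> 0\<close> by (simp add: divide_le_eq mult_ac)
  qed
qed

text \<open>
  The entries of the product are finite sums of Cauchy products of absolutely convergent real series, and the coefficient
  of \<open>X\<^sup>k\<close> is that of \<open>exp(1) exp(-1)\<close>, which is \<open>(1 - 1)\<^sup>k / k!\<close>.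
\<close>

lemma mat_exp_minus_inverse:
  fixes X :: "real^'n^'n"
  shows "mat_exp X ** mat_exp (- X) = mat 1"
proof -
  define e where "e Y i j k = (1 / fact k) * mat_pow Y k $ i $ j" for Y :: "real^'n^'n" and i j k
  have entry: "bounded_linear (\<lambda>A :: real^'n^'n. A $ i $ j)" for i j
    using bounded_linear_compose[OF bounded_linear_vec_nth bounded_linear_vec_nth] .
  have e_sums: "e Y i j sums (mat_exp Y $ i $ j)" and e_abs: "summable (\<lambda>k. norm (e Y i j k))"
    for Y :: "real^'n^'n" and i j
  proof -
    have "(\<lambda>k. (1 / fact k) *\<^sub>R mat_pow Y k) sums mat_exp Y"
      using summable_mat_series[of "\<lambda>k. 1 / fact k" Y] unfolding mat_exp_def
      by (simp add: summable_sums)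
    from bounded_linear.sums[OF entry this] show "e Y i j sums (mat_exp Y $ i $ j)"
      unfolding e_def by simp
    have "\<bar>1 / fact k\<bar> \<le> 1 / (fact k :: real)" for k by simp
    then obtain m where m: "summable m"
      "\<And>(B :: real^'n^'n) k. norm B \<le> norm Y \<Longrightarrow> norm ((1 / fact k) *\<^sub>R mat_pow B k) \<le> m k"
      using mat_series_majorant[of "\<lambda>k. 1 / fact k", OF _ norm_ge_zero[of Y]] by metis
    have "norm (norm (e Y i j k)) \<le> m k" for k
    proof -
      have "norm (e Y i j k) = norm (((1 / fact k) *\<^sub>R mat_pow Y k) $ i $ j)"
        unfolding e_def by simp
      also have "\<dots> \<le> norm ((1 / fact k) *\<^sub>R mat_pow Y k)"
        by (rule order_trans[OF Finite_Cartesian_Product.norm_nth_le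
              Finite_Cartesian_Product.norm_nth_le])
      finally show ?thesis using m(2)[of Y k] by simp
    qed
    then show "summable (\<lambda>k. norm (e Y i j k))"
      using m(1) by (blast intro: summable_comparison_test)
  qed
  have binom: "(\<Sum>i\<le>k. (1 / fact i) * ((1 / fact (k - i)) * (-1) ^ (k - i))) = (if k = 0 then 1 else 0 :: real)"
    for k :: nat
    using exp_series_add_commuting[of "1 :: real" "-1" k] by (cases k) (simp_all add: divide_inverse mult_ac)
  have coeff: "(\<Sum>l\<in>UNIV. \<Sum>i\<le>k. e X a l i * e (- X) l b (k - i)) = (if k = 0 then mat 1 $ a $ b else 0)"
    for a b k
  proof -
    \<comment> \<open>The powers of \<open>X\<close> combine to \<open>X\<^sup>k\<close>, which leaves a sum of scalar coefficients.\<close>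
    have "mat_pow (- X) j = (-1) ^ j *\<^sub>R mat_pow X j" for j
      using mat_pow_scaleR[of "-1" X j] by simp
    then have "(\<Sum>l\<in>UNIV. \<Sum>i\<le>k. e X a l i * e (- X) l b (k - i)) =
        (\<Sum>i\<le>k. (1 / fact i) * ((1 / fact (k - i)) * (-1) ^ (k - i)) *
          (mat_pow X i ** mat_pow X (k - i)) $ a $ b)"
      by (subst sum.swap) (simp add: e_def matrix_matrix_mult_def sum_distrib_left mult_ac)
    also have "\<dots> = (\<Sum>i\<le>k. (1 / fact i) * ((1 / fact (k - i)) * (-1) ^ (k - i))) * mat_pow X k $ a $ b"
      unfolding sum_distrib_right by (rule sum.cong) (simp_all flip: mat_pow_add)
    finally show ?thesis unfolding binom by simp
  qed
  have "(mat_exp X ** mat_exp (- X)) $ a $ b = mat 1 $ a $ b" for a b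
  proof -
    have "(\<lambda>k. \<Sum>i\<le>k. e X a l i * e (- X) l b (k - i)) sums (mat_exp X $ a $ l * mat_exp (- X) $ l $ b)" for l
      using Cauchy_product_sums[OF e_abs[of X a l] e_abs[of "- X" l b]]
      by (simp only: sums_unique[OF e_sums, symmetric])
    then have "(\<lambda>k. \<Sum>l\<in>UNIV. \<Sum>i\<le>k. e X a l i * e (- X) l b (k - i)) sums
        (\<Sum>l\<in>UNIV. mat_exp X $ a $ l * mat_exp (- X) $ l $ b)"
      by (intro sums_sum) auto
    then have "(\<lambda>k. if k = 0 then mat 1 $ a $ b else 0 :: real) sums ((mat_exp X ** mat_exp (- X)) $ a $ b)"
      by (simp add: coeff matrix_matrix_mult_def)
    moreover have "(\<lambda>k. if k = 0 then mat 1 $ a $ b else 0 :: real) sums (mat 1 $ a $ b)"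
      using sums_single[of 0 "\<lambda>_. mat 1 $ a $ b :: real"] by simp
    ultimately show ?thesis using sums_unique2 by blast
  qed
  then show ?thesis by (simp add: vec_eq_iff)
qed

section \<open>Neighbourhoods in orbits under conjugation\<close>

text \<open>
  The derivative of \<open>X \<mapsto> exp(X) N exp(-X)\<close> at \<open>0\<close> is \<open>X \<mapsto> [X, N]\<close>, which maps \<open>G\<close> onto \<open>U\<close>. To apply an open
  mapping theorem on the whole matrix space, this map is precomposed with a linear section over \<open>U\<close> of the derivative
  and extended by the identity on a complement of \<open>U\<close>. The resulting map \<open>f\<close> has derivative \<open>id\<close> at \<open>0\<close>,
  and a point of \<open>U\<close> in its range has no component in the complement.
\<close>

proposition conjugation_orbit_neighbourhood:
  fixes N :: "real^'n^'n"
  assumes G: "subspace G" and U: "subspace U" and NU: "N \<in> U"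
    and stable: "\<And>X. X \<in> G \<Longrightarrow> mat_exp X ** N ** mat_exp (- X) \<in> U"
    and onto: "\<And>Z. Z \<in> U \<Longrightarrow> \<exists>A \<in> G. A ** N - N ** A = Z"
  obtains T where "open T" "N \<in> T" "T \<inter> U \<subseteq> {mat_exp X ** N ** mat_exp (- X) | X. X \<in> G}"
proof -
  let ?L = "\<lambda>A. A ** N - N ** A"
  have "linear ?L"
    by (rule linearI) (simp_all add: matrix_mult.add_left matrix_mult.add_right
        matrix_mult.scaleR_left matrix_mult.scaleR_right scaleR_diff_right)
  then obtain s where s: "range s \<subseteq> G" "linear s" "\<forall>Z\<in>?L ` G. ?L (s Z) = Z"
    using real_vector.linear_exists_right_inverse_on[OF _ G] by blast
  obtain \<pi> where \<pi>: "range \<pi> \<subseteq> U" "linear \<pi>" "\<forall>Z\<in>U. \<pi> (id Z) = Z"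
    using real_vector.linear_exists_left_inverse_on[OF linear_id U inj_on_id] by blast
  define r where "r Z = s (\<pi> Z)" for Z
  have linr: "linear r" unfolding r_def using linear_compose[OF \<pi>(2) s(2)] by (simp add: o_def)
  have rG: "r Z \<in> G" for Z using s(1) by (auto simp: r_def)
  have Lr: "?L (r Z) = \<pi> Z" for Z
  proof -
    have "\<pi> Z \<in> U" using \<pi>(1) by blast
    from onto[OF this] obtain A where "A \<in> G" "?L A = \<pi> Z" by blast
    then have "\<pi> Z \<in> ?L ` G" by (metis (no_types, lifting) image_eqI)
    from s(3)[rule_format, OF this] show ?thesis by (simp only: r_def)
  qed
  \<comment> \<open>The last summand is the component of \<open>Z\<close> in the kernel of \<open>\<pi>\<close>, a complement of \<open>U\<close>.\<close>
  define f where "f Z = mat_exp (r Z) ** N ** mat_exp (- r Z) + (Z - \<pi> Z)" for Z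
  note bl = linr[unfolded linear_conv_bounded_linear] \<pi>(2)[unfolded linear_conv_bounded_linear]
  have cont: "continuous_on UNIV f"
    unfolding f_def
    by (intro continuous_intros matrix_mult.continuous_on linear_continuous_on bl)
  have r0: "r 0 = 0" and \<pi>0: "\<pi> 0 = 0"
    using linr \<pi>(2) by (simp_all add: linear_0)
  have r_deriv: "(r has_derivative r) (at 0)" and \<pi>_deriv: "(\<pi> has_derivative \<pi>) (at 0)"
    using bl by (auto intro: bounded_linear_imp_has_derivative)
  have exp_deriv: "((\<lambda>Z. mat_exp (g Z)) has_derivative g) (at 0)"
    if "(g has_derivative g) (at 0)" "g 0 = 0" for g :: "real^'n^'n \<Rightarrow> real^'n^'n"
    using has_derivative_compose[OF that(1), of mat_exp "\<lambda>X. X"] mat_exp_has_derivative_at_0 that(2)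
    by simp
  have "((\<lambda>Z. mat_exp (r Z)) has_derivative r) (at 0)"
    by (rule exp_deriv[OF r_deriv r0])
  moreover have "((\<lambda>Z. mat_exp (- r Z)) has_derivative (\<lambda>Z. - r Z)) (at 0)"
    using r0 by (intro exp_deriv has_derivative_minus r_deriv) auto
  ultimately have "(f has_derivative (\<lambda>Z. (mat_exp (r 0) ** N) ** (- r Z)
      + (mat_exp (r 0) ** 0 + r Z ** N) ** mat_exp (- r 0) + (Z - \<pi> Z))) (at 0)"
    unfolding f_def
    by (intro has_derivative_add has_derivative_diff has_derivative_ident \<pi>_deriv
        matrix_mult.FDERIV has_derivative_const)
  moreover have "(mat_exp (r 0) ** N) ** (- r Z)
      + (mat_exp (r 0) ** 0 + r Z ** N) ** mat_exp (- r 0) + (Z - \<pi> Z) = Z" for Z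
    using Lr[of Z] by (simp add: r0 matrix_mult.minus_right matrix_mult.zero_right algebra_simps)
  ultimately have "(f has_derivative (\<lambda>Z. Z)) (at 0)"
    by (simp only:)
  from sussmann_open_mapping[OF open_UNIV cont UNIV_I this bounded_linear_ident _ subset_UNIV, of UNIV]
  have "f 0 \<in> interior (range f)" by (simp add: o_def id_def)
  then have "N \<in> interior (range f)" by (simp add: f_def r0 \<pi>0)
  moreover have "Y \<in> {mat_exp X ** N ** mat_exp (- X) | X. X \<in> G}" if "Y \<in> range f" "Y \<in> U" for Y
  proof -
    obtain Z where Z: "Y = f Z" using \<open>Y \<in> range f\<close> by blast
    have "Z - \<pi> Z = Y - mat_exp (r Z) ** N ** mat_exp (- r Z)"
      by (simp add: Z f_def)
    then have "Z - \<pi> Z \<in> U"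
      using subspace_diff[OF U \<open>Y \<in> U\<close> stable[OF rG]] by simp
    then have "Z - \<pi> Z = \<pi> (Z - \<pi> Z)" using \<pi>(3) by simp
    also have "\<dots> = 0" using \<pi> by (simp add: linear_diff image_subset_iff)
    finally show ?thesis using rG[of Z] by (auto simp: Z f_def)
  qed
  then have "interior (range f) \<inter> U \<subseteq> {mat_exp X ** N ** mat_exp (- X) | X. X \<in> G}"
    using interior_subset by blast
  ultimately show thesis
    using that[OF open_interior] by blast
qed

section \<open>Conjugation\<close>

lemma matrix_inv_unique:
  assumes "A ** B = mat 1" "B ** A = mat 1"
  shows "matrix_inv A = B"
proof -
  have inv: "A ** matrix_inv A = mat 1 \<and> matrix_inv A ** A = mat 1"
    unfolding matrix_inv_def by (rule someI[of _ B]) (simp add: assms)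
  have "matrix_inv A = matrix_inv A ** (A ** B)" by (simp add: assms)
  also have "\<dots> = B" using inv by (simp add: matrix_mul_assoc)
  finally show ?thesis .
qed

lemma matrix_inv_inverse:
  assumes "invertible A"
  shows "A ** matrix_inv A = mat 1" "matrix_inv A ** A = mat 1"
proof -
  obtain B where B: "A ** B = mat 1" "B ** A = mat 1"
    using assms unfolding invertible_def by blast
  then show "A ** matrix_inv A = mat 1" "matrix_inv A ** A = mat 1"
    using matrix_inv_unique[OF B] by simp_all
qed

lemma matrix_inv_mult:
  assumes "invertible A" "invertible B"
  shows "matrix_inv (A ** B) = matrix_inv B ** matrix_inv A"
proof (rule matrix_inv_unique)
  have "A ** B ** (matrix_inv B ** matrix_inv A) = A ** (B ** matrix_inv B) ** matrix_inv A"
    by (simp add: matrix_mul_assoc)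
  then show "A ** B ** (matrix_inv B ** matrix_inv A) = mat 1"
    using assms by (simp add: matrix_inv_inverse)
  have "matrix_inv B ** matrix_inv A ** (A ** B) = matrix_inv B ** (matrix_inv A ** A) ** B"
    by (simp add: matrix_mul_assoc)
  then show "matrix_inv B ** matrix_inv A ** (A ** B) = mat 1"
    using assms by (simp add: matrix_inv_inverse)
qed

lemma matrix_inv_mat_exp: "matrix_inv (mat_exp X) = mat_exp (- X)" for X :: "real^'n^'n"
  using mat_exp_minus_inverse[of X] mat_exp_minus_inverse[of "- X"] by (intro matrix_inv_unique) auto

lemma mat_pow_conjugate:
  assumes "b ** a = mat 1"  and "a ** b = mat 1"
  shows "mat_pow (a ** N ** b) k = a ** mat_pow N k ** b"
proof (induction k)
  case (Suc k)
  have "mat_pow (a ** N ** b) (Suc k) = a ** N ** (b ** a) ** mat_pow N k ** b"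
    by (simp add: Suc matrix_mul_assoc)
  then show ?case by (simp add: assms matrix_mul_assoc)
qed (simp add: assms)

lemma is_weight_filtration_conjugate:
  assumes W: "is_weight_filtration N W" and inv: "a ** b = mat 1" "b ** a = mat 1"
    and a: "\<And>k x. x \<in> W k \<Longrightarrow> a *v x \<in> W k" and b: "\<And>k x. x \<in> W k \<Longrightarrow> b *v x \<in> W k"
  shows "is_weight_filtration (a ** N ** b) W"
proof -
  have ab: "a *v (b *v x) = x" "b *v (a *v x) = x" for x
    using inv by (simp_all add: matrix_vector_mul_assoc)
  have pow: "mat_pow (a ** N ** b) k *v x = a *v (mat_pow N k *v (b *v x))" for k x
    by (simp add: mat_pow_conjugate[OF inv(2,1)] matrix_vector_mul_assoc matrix_mul_assoc)
  have "(a ** N ** b) *v x \<in> W (k - 2)" if "x \<in> W k" for k x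
  proof -
    have "N *v (b *v x) \<in> W (k - 2)" using W b[OF that] unfolding is_weight_filtration_def by blast
    from a[OF this] show ?thesis by (simp flip: matrix_vector_mul_assoc)
  qed
  moreover have "x \<in> W (int k - 1)"
    if "x \<in> W (int k)" "mat_pow (a ** N ** b) k *v x \<in> W (- int k - 1)" for k x
  proof -
    have "mat_pow N k *v (b *v x) \<in> W (- int k - 1)"
      using b[OF that(2)] by (simp add: pow ab)
    then have "b *v x \<in> W (int k - 1)"
      using W b[OF that(1)] unfolding is_weight_filtration_def by blast
    from a[OF this] show ?thesis by (simp add: ab)
  qed
  moreover have "\<exists>x \<in> W (int k). y - mat_pow (a ** N ** b) k *v x \<in> W (- int k - 1)"
    if y: "y \<in> W (- int k)" for k y
  proof -
    obtain x where x: "x \<in> W (int k)" "b *v y - mat_pow N k *v x \<in> W (- int k - 1)"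
      using W b[OF y] unfolding is_weight_filtration_def by blast
    have "y - mat_pow (a ** N ** b) k *v (a *v x) = a *v (b *v y - mat_pow N k *v x)"
      by (simp add: pow ab matrix_vector_mult_diff_distrib)
    then show ?thesis using a[OF x(1)] a[OF x(2)] by metis
  qed
  ultimately show ?thesis
    using W unfolding is_weight_filtration_def by (simp add: image_subset_iff)
qed

lemma lie_g_real_conjugate:
  assumes N: "N \<in> lie_g_real Q" and a: "a \<in> aut_group Q"
  shows "a ** N ** matrix_inv a \<in> lie_g_real Q"
proof -
  let ?b = "matrix_inv a"
  have inv: "a ** ?b = mat 1" and Q: "\<And>x y. Q (a *v x) (a *v y) = Q x y"
    using a by (simp_all add: aut_group_def matrix_inv_inverse)
  have ab: "a *v (?b *v x) = x" for x
    using inv by (simp add: matrix_vector_mul_assoc)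
  have "Q ((a ** N ** ?b) *v x) y + Q x ((a ** N ** ?b) *v y) = 0" for x y
  proof -
    have "Q ((a ** N ** ?b) *v x) y = Q (N *v (?b *v x)) (?b *v y)"
      using Q[of "N *v (?b *v x)" "?b *v y"] by (simp add: ab flip: matrix_vector_mul_assoc)
    moreover have "Q x ((a ** N ** ?b) *v y) = Q (?b *v x) (N *v (?b *v y))"
      using Q[of "?b *v x" "N *v (?b *v y)"] by (simp add: ab flip: matrix_vector_mul_assoc)
    ultimately show ?thesis using N by (simp add: lie_g_real_def)
  qed
  then show ?thesis by (simp add: lie_g_real_def)
qed

lemma linear_cmat_apply: "linear (\<lambda>A :: real^'n^'n. cmat A *v v)"
  by (rule linearI) (simp_all add: cmat_def vec_eq_iff matrix_vector_mult_def algebra_simps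
      sum.distrib scaleR_conv_of_real[where 'a=complex] sum_distrib_left)

lemma subspace_if_vec_subspace:
  fixes S :: "(complex^'n) set"
  assumes "vec.subspace S" shows "subspace S"
proof -
  have "c *\<^sub>R v = complex_of_real c *s v" for c and v :: "complex^'n"
    by (simp add: vec_eq_iff scaleR_conv_of_real[where 'a=complex])
  then show ?thesis using assms by (simp add: vec.subspace_def subspace_def)
qed

text \<open>
  The partial sums of the exponential series preserve \<open>S\<close>, and \<open>S\<close> is closed.
\<close>

lemma cmat_mat_exp_invariant:
  fixes X :: "real^'n^'n"
  assumes S: "vec.subspace S" and X: "\<And>v. v \<in> S \<Longrightarrow> cmat X *v v \<in> S" and v: "v \<in> S"
  shows "cmat (mat_exp X) *v v \<in> S"
proof -
  have sub: "subspace S" by (rule subspace_if_vec_subspace[OF S])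
  have pow: "cmat (mat_pow X k) *v v \<in> S" for k
    by (induction k) (use X v in \<open>simp_all add: cmat_mult flip: matrix_vector_mul_assoc\<close>)
  have "(\<lambda>k. (1 / fact k) *\<^sub>R mat_pow X k) sums mat_exp X"
    using summable_mat_series[of "\<lambda>k. 1 / fact k" X] by (simp add: mat_exp_def summable_sums)
  then have "(\<lambda>k. cmat ((1 / fact k) *\<^sub>R mat_pow X k) *v v) sums (cmat (mat_exp X) *v v)"
    by (rule bounded_linear.sums[OF linear_cmat_apply[unfolded linear_conv_bounded_linear]])
  then have lim: "(\<lambda>n. \<Sum>k<n. (1 / fact k) *\<^sub>R (cmat (mat_pow X k) *v v)) \<longlonglongrightarrow> cmat (mat_exp X) *v v"
    by (simp only: sums_def linear_scale[OF linear_cmat_apply])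
  have "(\<Sum>k<n. (1 / fact k) *\<^sub>R (cmat (mat_pow X k) *v v)) \<in> S" for n
    using pow sub by (intro subspace_sum subspace_scale)
  then show ?thesis
    using closed_sequentially[OF closed_subspace[OF sub] _ lim] by blast
qed

section \<open>Endomorphisms of type \<open>(-1, -1)\<close>\<close>

text \<open>
  The linear data of an \<open>\<real>\<close>-split nilpotent orbit. Here \<open>\<epsilon>\<close> is the sign \<open>(-1)\<^sup>w\<close>, and the weight filtration is centred at
  \<open>0\<close>, whence the shift by \<open>w\<close> in the last condition.
\<close>

locale polarized_split_bigrading = projected_bigrading V S P
  for V :: "int \<Rightarrow> int \<Rightarrow> (complex^'n) set" and S P +
  fixes w :: int and Q :: "real^'n \<Rightarrow> real^'n \<Rightarrow> real" and \<epsilon> :: real and N :: "real^'n^'n"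
  assumes bilinear: "bilinear Q"
    and symmetric: "\<And>x y. Q y x = \<epsilon> * Q x y"
    and nondegenerate: "\<And>x. (\<And>y. Q x y = 0) \<Longrightarrow> x = 0"
    and split: "split_over_reals V"
    and orthogonal_pieces: "\<And>p q r s u v. u \<in> V p q \<Longrightarrow> v \<in> V r s \<Longrightarrow>
          \<not> (p + r = w \<and> q + s = w) \<Longrightarrow> complex_form Q u v = 0"
    and N_nilpotent: "mat_nilpotent N"
    and N_type: "N \<in> lie_g_diag_real Q V (-1)"
    and weight_pieces: "\<And>k. complexify (weight_filtration N k) =
          vec.span (\<Union>{V r s | r s. r + s \<le> k + w})"
begin

abbreviation "L \<equiv> same_weight_locus Q V N"

lemma lie_g_diag_real_iff:
  "X \<in> lie_g_diag_real Q V p \<longleftrightarrow>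
    X \<in> lie_g_real Q \<and> (\<forall>r s. \<forall>v \<in> V r s. cmat X *v v \<in> V (r + p) (s + p))"
  by (auto simp: lie_g_diag_real_def lie_g_bigraded_def cmat_in_lie_g_complex_iff[OF bilinear])

lemma subspace_lie_g_diag_real: "subspace (lie_g_diag_real Q V p)"
proof -
  have "subspace (lie_g_real Q)"
    using bilinear by (simp add: subspace_def lie_g_real_def bilinear_ladd bilinear_radd bilinear_lzero
        bilinear_rzero bilinear_lmul bilinear_rmul matrix_vector_mult_add_rdistrib
        scaleR_matrix_vector_assoc[symmetric] algebra_simps add_eq_0_iff)
  moreover have "subspace {X. \<forall>r s. \<forall>v \<in> V r s. cmat X *v v \<in> V (r + p) (s + p)}"
  proof -
    have "subspace {X. cmat X *v v \<in> V r s}" for r s and v :: "complex^'n"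
      using linear_subspace_vimage[OF linear_cmat_apply subspace_if_vec_subspace[OF subspace_piece]]
      by (simp add: vimage_def)
    then show ?thesis by (simp add: subspace_def)
  qed
  moreover have "lie_g_diag_real Q V p =
      lie_g_real Q \<inter> {X. \<forall>r s. \<forall>v \<in> V r s. cmat X *v v \<in> V (r + p) (s + p)}"
    using lie_g_diag_real_iff by blast
  ultimately show ?thesis by (simp add: subspace_inter)
qed

lemma is_weight_filtration_N: "is_weight_filtration N (weight_filtration N)"
  by (simp add: weight_filtration_eq_kernel_filtration is_weight_filtration_kernel_filtration N_nilpotent)

lemma subspace_weight: "subspace (weight_filtration N k)"
  by (simp add: weight_filtration_eq_kernel_filtration N_nilpotent)

text \<open>
  Membership in \<open>W\<close> can be tested after complexification, where \<open>W\<close> is a sum of pieces.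
\<close>

lemma bigraded_weight:
  assumes X: "\<And>r s v. v \<in> V r s \<Longrightarrow> cmat X *v v \<in> V (r + p) (s + p)"
    and x: "x \<in> weight_filtration N k"
  shows "X *v x \<in> weight_filtration N (k + 2 * p)"
proof -
  have "complexify (weight_filtration N k) \<subseteq> {v. cmat X *v v \<in> complexify (weight_filtration N (k + 2 * p))}"
    unfolding weight_pieces[of k]
  proof (rule vec.span_minimal)
    show "\<Union>{V r s | r s. r + s \<le> k + w} \<subseteq> {v. cmat X *v v \<in> complexify (weight_filtration N (k + 2 * p))}"
    proof clarify
      fix v r s assume "v \<in> V r s" "r + s \<le> k + w"
      then have "cmat X *v v \<in> V (r + p) (s + p)" "(r + p) + (s + p) \<le> k + 2 * p + w"
        using X[of v r s] by simp_all
      then have "cmat X *v v \<in> \<Union>{V r s | r s. r + s \<le> k + 2 * p + w}"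
        by blast
      then show "cmat X *v v \<in> complexify (weight_filtration N (k + 2 * p))"
        unfolding weight_pieces by (rule vec.span_base)
    qed
    show "vec.subspace {v. cmat X *v v \<in> complexify (weight_filtration N (k + 2 * p))}"
      by (rule complex_subspace_preimage) (simp add: complexify_def)
  qed
  then show ?thesis
    using x cmat_complexify_iff[OF subspace_weight] by blast
qed

text \<open>
  An endomorphism of type \<open>(-1, -1)\<close> lowers the finite filtration \<open>W\<close>.
\<close>

lemma diagonal_nilpotent:
  assumes "X \<in> lie_g_diag_real Q V (-1)"
  shows "mat_nilpotent X"
proof -
  have step: "X *v x \<in> weight_filtration N (k - 2)" if "x \<in> weight_filtration N k" for x k
    using bigraded_weight[of X "-1" x k] assms that by (simp add: lie_g_diag_real_iff)
  have pow: "mat_pow X j *v x \<in> weight_filtration N (k - 2 * int j)" if "x \<in> weight_filtration N k" for x k j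
  proof (induction j)
    case (Suc j)
    then show ?case using step[of "mat_pow X j *v x" "k - 2 * int j"]
      by (simp add: matrix_vector_mul_assoc algebra_simps)
  qed (use that in simp)
  obtain b t where b: "weight_filtration N b = {0}" and t: "weight_filtration N t = UNIV"
      and mono: "mono (weight_filtration N)"
    using is_weight_filtration_N unfolding is_weight_filtration_def increasing_filtration_def by auto
  have "mat_pow X (nat (t - b)) *v x = 0" for x
  proof -
    have "mat_pow X (nat (t - b)) *v x \<in> weight_filtration N (t - 2 * int (nat (t - b)))"
      using pow[of x t] t by blast
    moreover have "weight_filtration N (t - 2 * int (nat (t - b))) \<subseteq> weight_filtration N b"
      by (rule monoD[OF mono]) linarith
    ultimately show ?thesis using b by auto
  qed
  then show ?thesis
    unfolding mat_nilpotent_def by (metis matrix_eq matrix_vector_mult_0)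
qed

text \<open>
  Elements of type \<open>(-1, -1)\<close> lower the weight filtration of \<open>N'\<close> by \<open>2\<close>, so \<open>[A, N'] = Z\<close> has a solution in \<open>gl(V)\<close>. It
  is made skew by averaging with minus its adjoint, and then replaced by its component of type \<open>(0, 0)\<close>, which is again
  real because the bigrading is split, and skew because \<open>Q\<close> respects the bigrading.
\<close>

proposition ad_surjective:
  assumes N': "N' \<in> L" and Z: "Z \<in> lie_g_diag_real Q V (-1)"
  shows "\<exists>A \<in> lie_g_diag_real Q V 0. A ** N' - N' ** A = Z"
proof -
  have N'_type: "N' \<in> lie_g_diag_real Q V (-1)" and same: "weight_filtration N' = weight_filtration N"
    using N' by (simp_all add: same_weight_locus_def)
  have "Z *v x \<in> weight_filtration N' (k - 1)" if "x \<in> weight_filtration N' k" for k x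
  proof -
    have "Z *v x \<in> weight_filtration N (k - 2)"
      using bigraded_weight[of Z "-1" x k] Z that same by (simp add: lie_g_diag_real_iff)
    moreover have "weight_filtration N (k - 2) \<subseteq> weight_filtration N (k - 1)"
      using kernel_filtration_mono[of "k - 2" "k - 1" N]
      by (simp add: weight_filtration_eq_kernel_filtration N_nilpotent)
    ultimately show ?thesis using same by auto
  qed
  then obtain A where "A ** N' - N' ** A = Z"
    using lowering_in_range_ad[OF diagonal_nilpotent[OF N'_type]] by blast
  then have "\<exists>B \<in> lie_g_real Q. B ** N' - N' ** B = Z"
    by (intro skew_preimage_ad[OF bilinear symmetric nondegenerate])
      (use N'_type Z in \<open>simp_all add: lie_g_diag_real_iff\<close>)
  then obtain B where B: "B \<in> lie_g_real Q" "B ** N' - N' ** B = Z" by blast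
  obtain C where C: "diagonal_part (cmat B) = cmat C"
    using diagonal_part_real[OF split] by blast
  have "cmat C ** cmat N' - cmat N' ** cmat C = cmat Z"
    unfolding C[symmetric]
  proof (rule diagonal_part_bracket)
    show "cmat B ** cmat N' - cmat N' ** cmat B = cmat Z"
      using B(2) by (simp flip: cmat_mult cmat_diff)
  qed (use N'_type Z in \<open>auto simp: lie_g_diag_real_iff\<close>)
  then have "C ** N' - N' ** C = Z"
    by (simp flip: cmat_mult cmat_diff)
  moreover have "C \<in> lie_g_diag_real Q V 0"
  proof -
    have "diagonal_part (cmat B) \<in> lie_g_complex Q"
      by (rule diagonal_part_skew[OF orthogonal_pieces])
        (use B(1) in \<open>simp_all add: cmat_in_lie_g_complex_iff[OF bilinear]\<close>)
    then have "C \<in> lie_g_real Q"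
      by (simp add: C cmat_in_lie_g_complex_iff[OF bilinear])
    moreover have "cmat C *v v \<in> V p q" if "v \<in> V p q" for p q v
      by (simp add: C[symmetric] diagonal_part_piece[OF that] proj_in)
    ultimately show ?thesis by (simp add: lie_g_diag_real_iff)
  qed
  ultimately show ?thesis by blast
qed

text \<open>
  An automorphism that preserves the pieces preserves \<open>W\<close>, so \<open>W\<close> is also the weight filtration of the conjugate of
  \<open>N'\<close>, by uniqueness.
\<close>

lemma locus_conjugate:
  assumes a: "a \<in> aut_group Q" and N': "N' \<in> L"
    and pres: "\<And>p q v. v \<in> V p q \<Longrightarrow> cmat a *v v \<in> V p q"
    and pres_inv: "\<And>p q v. v \<in> V p q \<Longrightarrow> cmat (matrix_inv a) *v v \<in> V p q"
  shows "a ** N' ** matrix_inv a \<in> L"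
proof -
  let ?N' = "a ** N' ** matrix_inv a"
  have inv: "a ** matrix_inv a = mat 1" "matrix_inv a ** a = mat 1"
    using a by (simp_all add: aut_group_def matrix_inv_inverse)
  have N'_type: "N' \<in> lie_g_diag_real Q V (-1)" and same: "weight_filtration N' = weight_filtration N"
    using N' by (simp_all add: same_weight_locus_def)
  have "cmat ?N' *v v \<in> V (p - 1) (q - 1)" if "v \<in> V p q" for p q v
  proof -
    have "cmat N' *v (cmat (matrix_inv a) *v v) \<in> V (p - 1) (q - 1)"
      using N'_type pres_inv[OF that] by (simp add: lie_g_diag_real_iff)
    from pres[OF this] show ?thesis by (simp add: cmat_mult flip: matrix_vector_mul_assoc)
  qed
  then have type: "?N' \<in> lie_g_diag_real Q V (-1)"
    using lie_g_real_conjugate[OF _ a] N'_type by (simp add: lie_g_diag_real_iff)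
  have "is_weight_filtration N' (weight_filtration N)"
    using same is_weight_filtration_kernel_filtration[OF diagonal_nilpotent[OF N'_type]]
    by (simp add: weight_filtration_eq_kernel_filtration[OF diagonal_nilpotent[OF N'_type]])
  then have "is_weight_filtration ?N' (weight_filtration N)"
    using bigraded_weight[of a 0] bigraded_weight[of "matrix_inv a" 0] pres pres_inv
    by (intro is_weight_filtration_conjugate[OF _ inv]) auto
  then have "weight_filtration N = weight_filtration ?N'"
    using weight_filtration_unique[of ?N'] by (simp add: weight_filtration_eq_kernel_filtration[OF diagonal_nilpotent[OF type]])
  with type show ?thesis by (simp add: same_weight_locus_def)
qed

end

section \<open>Orbits of \<open>M\<close> on the locus of constant weight filtration\<close>

text \<open>
  The group \<open>M\<close> is the connected subgroup \<open>M\<^sup>0\<close> of the automorphism group with Lie algebra of type \<open>(0, 0)\<close>.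
\<close>

locale bigraded_centralizer = polarized_split_bigrading V S P w Q \<epsilon> N
  for V :: "int \<Rightarrow> int \<Rightarrow> (complex^'n) set" and S P w Q \<epsilon> N +
  fixes M :: "(real^'n^'n) set"
  assumes M: "connected_lie_subgroup (aut_group Q) M" and lie_M: "lie_algebra_of M = lie_g_diag_real Q V 0"
begin

lemma M_group:
  "a \<in> M \<Longrightarrow> invertible a" "mat 1 \<in> M" "a \<in> M \<Longrightarrow> b \<in> M \<Longrightarrow> a ** b \<in> M" "a \<in> M \<Longrightarrow> matrix_inv a \<in> M"
  using M unfolding connected_lie_subgroup_def aut_group_def by auto

lemma exp_in_M:
  assumes "X \<in> lie_g_diag_real Q V 0"
  shows "mat_exp (t *\<^sub>R X) \<in> M"
  using assms lie_M unfolding lie_algebra_of_def by auto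

lemma M_product:
  assumes "a \<in> M"
  obtains Xs where "set Xs \<subseteq> lie_g_diag_real Q V 0" "a = foldr (**) (map mat_exp Xs) (mat 1)"
  using M assms lie_M unfolding connected_lie_subgroup_def by auto

lemma M_preserves:
  assumes "a \<in> M" "v \<in> V p q"
  shows "cmat a *v v \<in> V p q"
proof -
  obtain Xs where Xs: "set Xs \<subseteq> lie_g_diag_real Q V 0" "a = foldr (**) (map mat_exp Xs) (mat 1)"
    using M_product[OF assms(1)] .
  have "cmat (foldr (**) (map mat_exp Xs) (mat 1)) *v v \<in> V p q" if "set Xs \<subseteq> lie_g_diag_real Q V 0" for Xs
    using that
  proof (induction Xs)
    case (Cons X Xs)
    then show ?case
      by (auto simp: cmat_mult lie_g_diag_real_iff simp flip: matrix_vector_mul_assoc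
          intro!: cmat_mat_exp_invariant subspace_piece)
  qed (simp add: assms(2))
  then show ?thesis using Xs by simp
qed

lemma Ad_orbit_subset_locus:
  assumes "N' \<in> L" shows "Ad_orbit M N' \<subseteq> L"
proof -
  have "a ** N' ** matrix_inv a \<in> L" if "a \<in> M" for a
    by (rule locus_conjugate) (use that assms M M_preserves M_group in \<open>auto simp: connected_lie_subgroup_def\<close>)
  then show ?thesis by (auto simp: Ad_orbit_def)
qed

lemma mem_Ad_orbit_self: "N' \<in> Ad_orbit M N'"
proof -
  have "matrix_inv (mat 1 :: real^'n^'n) = mat 1" by (rule matrix_inv_unique) simp_all
  then show ?thesis using M_group(2) by (auto simp: Ad_orbit_def intro!: exI[of _ "mat 1"])
qed

lemma Ad_orbit_trans:
  assumes "N'' \<in> Ad_orbit M N'" shows "Ad_orbit M N'' \<subseteq> Ad_orbit M N'"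
proof
  fix X assume "X \<in> Ad_orbit M N''"
  then obtain a b where ab: "a \<in> M" "b \<in> M" "X = a ** (b ** N' ** matrix_inv b) ** matrix_inv a"
    using assms by (auto simp: Ad_orbit_def)
  then have "X = (a ** b) ** N' ** matrix_inv (a ** b)"
    by (simp add: matrix_inv_mult M_group matrix_mul_assoc)
  then show "X \<in> Ad_orbit M N'" using ab M_group(3) by (auto simp: Ad_orbit_def)
qed

lemma Ad_orbit_sym:
  assumes "N'' \<in> Ad_orbit M N'" shows "N' \<in> Ad_orbit M N''"
proof -
  obtain a where a: "a \<in> M" "N'' = a ** N' ** matrix_inv a"
    using assms by (auto simp: Ad_orbit_def)
  have inv: "a ** matrix_inv a = mat 1" "matrix_inv a ** a = mat 1"
    using M_group(1)[OF a(1)] by (simp_all add: matrix_inv_inverse)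
  have "matrix_inv (matrix_inv a) = a" by (rule matrix_inv_unique) (simp_all add: inv)
  then have "matrix_inv a ** N'' ** matrix_inv (matrix_inv a) =
      (matrix_inv a ** a) ** N' ** (matrix_inv a ** a)"
    by (simp add: a(2) matrix_mul_assoc)
  then have "N' = matrix_inv a ** N'' ** matrix_inv (matrix_inv a)" by (simp add: inv)
  then show ?thesis using M_group(4)[OF a(1)] unfolding Ad_orbit_def by blast
qed

lemma Ad_exp_in_orbit:
  assumes "X \<in> lie_g_diag_real Q V 0"
  shows "mat_exp (t *\<^sub>R X) ** N' ** mat_exp (- (t *\<^sub>R X)) \<in> Ad_orbit M N'"
  using exp_in_M[OF assms, of t] matrix_inv_mat_exp[of "t *\<^sub>R X"] unfolding Ad_orbit_def by force

text \<open>
  Every point \<open>N''\<close> of the orbit has the same weight filtration as \<open>N\<close>, so \<open>ad N''\<close> is surjective there as well; the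
  neighbourhood of \<open>N''\<close> obtained from exponentials lies in the orbit of \<open>N''\<close>, which is the orbit of \<open>N'\<close>.
\<close>

lemma openin_Ad_orbit:
  assumes "N' \<in> L"
  shows "openin (top_of_set (lie_g_diag_real Q V (-1))) (Ad_orbit M N')"
proof -
  let ?U = "lie_g_diag_real Q V (-1)"
  have LU: "L \<subseteq> ?U" by (auto simp: same_weight_locus_def)
  have "\<exists>T. openin (top_of_set ?U) T \<and> N'' \<in> T \<and> T \<subseteq> Ad_orbit M N'"
    if N'': "N'' \<in> Ad_orbit M N'" for N''
  proof -
    have L'': "N'' \<in> L" using Ad_orbit_subset_locus[OF assms] N'' by blast
    have stable: "mat_exp X ** N'' ** mat_exp (- X) \<in> ?U" if "X \<in> lie_g_diag_real Q V 0" for X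
      using Ad_exp_in_orbit[OF that, of 1 N''] Ad_orbit_subset_locus[OF L''] LU by auto
    obtain T where T: "open T" "N'' \<in> T"
      "T \<inter> ?U \<subseteq> {mat_exp X ** N'' ** mat_exp (- X) | X. X \<in> lie_g_diag_real Q V 0}"
      using conjugation_orbit_neighbourhood[OF subspace_lie_g_diag_real subspace_lie_g_diag_real _
          stable ad_surjective[OF L'']] L'' LU by blast
    have "{mat_exp X ** N'' ** mat_exp (- X) | X. X \<in> lie_g_diag_real Q V 0} \<subseteq> Ad_orbit M N''"
      using Ad_exp_in_orbit[of _ 1 N''] by auto
    then have "?U \<inter> T \<subseteq> Ad_orbit M N'"
      using T(3) Ad_orbit_trans[OF N''] by blast
    then show ?thesis
      using T(1,2) L'' LU by (intro exI[of _ "?U \<inter> T"]) (auto intro: openin_open_Int)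
  qed
  then show ?thesis by (subst openin_subopen) blast
qed

text \<open>
  An element of \<open>M\<close> is a product of exponentials. Replacing the leftmost factor \<open>exp(X)\<close> by \<open>exp(t X)\<close> gives a path inside
  the orbit, so the factors can be removed one at a time.
\<close>

lemma connected_Ad_orbit: "connected (Ad_orbit M N')"
proof -
  let ?C = "connected_component_set (Ad_orbit M N') N'"
  have "Ad_orbit M N' \<subseteq> ?C"
  proof
    fix B assume "B \<in> Ad_orbit M N'"
    then obtain a where a: "a \<in> M" "B = a ** N' ** matrix_inv a"
      by (auto simp: Ad_orbit_def)
    obtain Xs where Xs: "set Xs \<subseteq> lie_g_diag_real Q V 0" "a = foldr (**) (map mat_exp Xs) (mat 1)"
      using M_product[OF a(1)] .
    have "foldr (**) (map mat_exp Xs) (mat 1) \<in> M \<and>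
        foldr (**) (map mat_exp Xs) (mat 1) ** N' ** matrix_inv (foldr (**) (map mat_exp Xs) (mat 1)) \<in> ?C"
      if "set Xs \<subseteq> lie_g_diag_real Q V 0" for Xs
      using that
    proof (induction Xs)
      case Nil
      have "matrix_inv (mat 1 :: real^'n^'n) = mat 1" by (rule matrix_inv_unique) simp_all
      then show ?case using M_group(2) mem_Ad_orbit_self by (simp add: connected_component_refl)
    next
      case (Cons X Xs)
      define b where "b = foldr (**) (map mat_exp Xs) (mat 1)"
      define B where "B = b ** N' ** matrix_inv b"
      have b: "b \<in> M" and B: "B \<in> ?C" using Cons by (simp_all add: b_def B_def)
      have X: "X \<in> lie_g_diag_real Q V 0" using Cons.prems by simp
      have XM: "mat_exp X \<in> M" using exp_in_M[OF X, of 1] by simp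
      define \<gamma> where "\<gamma> t = mat_exp (t *\<^sub>R X) ** B ** mat_exp (- (t *\<^sub>R X))" for t :: real
      have "B \<in> Ad_orbit M N'" using B connected_component_subset by blast
      then have "\<gamma> ` {0..1} \<subseteq> Ad_orbit M N'"
        unfolding \<gamma>_def using Ad_exp_in_orbit[OF X] Ad_orbit_trans by blast
      moreover have "continuous_on {0..1} \<gamma>"
        unfolding \<gamma>_def by (intro continuous_intros matrix_mult.continuous_on)
      then have "connected (\<gamma> ` {0..1})"
        by (rule connected_continuous_image) simp
      ultimately have "connected_component (Ad_orbit M N') (\<gamma> 0) (\<gamma> 1)"
        unfolding connected_component_def by (metis atLeastAtMost_iff image_eqI order_refl zero_le_one)
      then have "\<gamma> 1 \<in> ?C"
        using B connected_component_trans by (fastforce simp: \<gamma>_def)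
      moreover have "\<gamma> 1 = (mat_exp X ** b) ** N' ** matrix_inv (mat_exp X ** b)"
        by (simp add: \<gamma>_def B_def matrix_inv_mult M_group b XM matrix_inv_mat_exp matrix_mul_assoc)
      ultimately show ?case using M_group(3)[OF XM b] by (simp add: b_def)
    qed
    then show "B \<in> ?C" using Xs a by simp
  qed
  then have "Ad_orbit M N' = ?C" using connected_component_subset by blast
  then show ?thesis by (metis connected_connected_component)
qed

text \<open>
  The orbits partition the locus into open sets. So each of them is also closed in the locus, and a connected set that
  meets an orbit is contained in it.
\<close>

theorem component_eq_orbit: "connected_component_set L N = Ad_orbit M N"
proof
  have NL: "N \<in> L" using N_type by (simp add: same_weight_locus_def)
  show "Ad_orbit M N \<subseteq> connected_component_set L N"
    by (rule connected_component_maximal[OF mem_Ad_orbit_self connected_Ad_orbit Ad_orbit_subset_locus[OF NL]])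
  let ?C = "connected_component_set L N"
  have open_in_L: "openin (top_of_set L) (Ad_orbit M N')" if "N' \<in> L" for N'
    using openin_subset_trans[OF openin_Ad_orbit[OF that] Ad_orbit_subset_locus[OF that]]
    by (auto simp: same_weight_locus_def)
  have "L - Ad_orbit M N = \<Union>(Ad_orbit M ` (L - Ad_orbit M N))"
  proof
    show "L - Ad_orbit M N \<subseteq> \<Union>(Ad_orbit M ` (L - Ad_orbit M N))"
      using mem_Ad_orbit_self by blast
    show "\<Union>(Ad_orbit M ` (L - Ad_orbit M N)) \<subseteq> L - Ad_orbit M N"
      using Ad_orbit_subset_locus Ad_orbit_sym Ad_orbit_trans by blast
  qed
  moreover have "openin (top_of_set L) (\<Union>(Ad_orbit M ` (L - Ad_orbit M N)))"
    using open_in_L by blast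
  ultimately have "openin (top_of_set L) (L - Ad_orbit M N)" by simp
  then obtain T T' where T: "open T" "Ad_orbit M N = L \<inter> T" and T': "open T'" "L - Ad_orbit M N = L \<inter> T'"
    using open_in_L[OF NL] by (auto simp: openin_open)
  have CL: "?C \<subseteq> L" by (rule connected_component_subset)
  have "T \<inter> ?C = {} \<or> T' \<inter> ?C = {}"
    by (rule connectedD[OF connected_connected_component T(1) T'(1)]) (use T(2) T'(2) CL in blast)+
  moreover have "N \<in> T \<inter> ?C"
    using NL T(2) mem_Ad_orbit_self[of N] by (simp add: connected_component_refl)
  ultimately show "?C \<subseteq> Ad_orbit M N" using T'(2) CL by blast
qed

end

section \<open>Linear data of an \<open>\<real>\<close>-split nilpotent orbit\<close>

context projected_bigrading
begin

lemma piece_in_span: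
  assumes "v \<in> V p q" "R p q"
  shows "v \<in> vec.span (\<Union>{V r s | r s. R r s})"
  using assms by (intro vec.span_base) blast

text \<open>
  In the split case \<open>V\<^sup>p\<^sup>,\<^sup>q\<close> is the intersection of \<open>F\<^sup>p\<close>, the conjugate of \<open>F\<^sup>q\<close> and \<open>W\<^sub>p\<^sub>+\<^sub>q\<close>. The real operator \<open>N\<close> shifts these
  three by \<open>1\<close>, \<open>1\<close> and \<open>2\<close>.
\<close>

lemma lowers_both_degrees:
  assumes split: "split_over_reals V"
    and F: "\<And>p. F p = vec.span (\<Union>{V r s | r s. r \<ge> p})"
    and W: "\<And>k. complexify (W k) = vec.span (\<Union>{V r s | r s. r + s \<le> k})"
    and NF: "\<And>p v. v \<in> F p \<Longrightarrow> cmat N *v v \<in> F (p - 1)"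
    and NW: "\<And>k x. x \<in> W k \<Longrightarrow> N *v x \<in> W (k - 2)"
    and v: "v \<in> V p q"
  shows "cmat N *v v \<in> V (p - 1) (q - 1)"
proof (rule in_pieceI)
  have F_low: "P r s *v (cmat N *v u) = 0" if u: "u \<in> V p q" and r: "r < p - 1" for u p q r s
  proof -
    have "u \<in> F p" unfolding F by (rule piece_in_span[OF u]) simp
    then have "cmat N *v u \<in> F (p - 1)" by (rule NF)
    then show ?thesis using r unfolding F span_pieces_iff by auto
  qed
  fix r s assume rs: "\<not> (r = p - 1 \<and> s = q - 1)"
  consider "r < p - 1" | "s < q - 1" | "r + s > p + q - 2" using rs by linarith
  then show "P r s *v (cmat N *v v) = 0"
  proof cases
    case 1
    then show ?thesis by (rule F_low[OF v])
  next
    case 2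
    have "conj_vec v \<in> V q p" using split v by (auto simp: split_over_reals_def)
    then have "P s r *v (cmat N *v conj_vec v) = 0" using 2 by (rule F_low)
    then have "conj_vec (P r s *v (cmat N *v v)) = 0"
      by (simp add: proj_conj[OF split, symmetric])
    then show ?thesis by simp
  next
    case 3
    have "v \<in> complexify (W (p + q))" unfolding W by (rule piece_in_span[OF v]) simp
    then have "cmat N *v v \<in> complexify (W (p + q - 2))"
      using cmat_complexify[of "W (p + q)" N] NW by blast
    then show ?thesis using 3 unfolding W span_pieces_iff by auto
  qed
qed

text \<open>
  Isotropy of \<open>F\<close> gives \<open>p + r \<le> w\<close> for pieces that are not orthogonal, its conjugate gives \<open>q + s \<le> w\<close>, and
  isotropy of \<open>W\<close> gives \<open>p + q + r + s \<ge> 2 w\<close>. All three together force equality.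
\<close>

lemma pieces_orthogonal:
  assumes split: "split_over_reals V"
    and F: "\<And>p. F p = vec.span (\<Union>{V r s | r s. r \<ge> p})"
    and W: "\<And>k. complexify (W k) = vec.span (\<Union>{V r s | r s. r + s \<le> k + w})"
    and QF: "\<And>p u v. u \<in> F p \<Longrightarrow> v \<in> F (w + 1 - p) \<Longrightarrow> complex_form Q u v = 0"
    and Q: "bilinear Q"
    and QW: "\<And>k l x y. x \<in> W k \<Longrightarrow> y \<in> W l \<Longrightarrow> k + l < 0 \<Longrightarrow> Q x y = 0"
    and u: "u \<in> V p q" and v: "v \<in> V r s" and pqrs: "\<not> (p + r = w \<and> q + s = w)"
  shows "complex_form Q u v = 0"
proof -
  have F_high: "complex_form Q u v = 0" if "u \<in> V p q" "v \<in> V r s" "p + r > w" for u v p q r s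
  proof -
    have "u \<in> F p" unfolding F by (rule piece_in_span[OF that(1)]) simp
    moreover have "v \<in> F (w + 1 - p)"
      unfolding F by (rule piece_in_span[OF that(2)]) (use that(3) in simp)
    ultimately show ?thesis by (rule QF)
  qed
  consider "p + r > w" | "q + s > w" | "(p + q - w) + (r + s - w) < 0" using pqrs by linarith
  then show ?thesis
  proof cases
    case 1
    then show ?thesis by (rule F_high[OF u v])
  next
    case 2
    have "conj_vec u \<in> V q p" "conj_vec v \<in> V s r"
      using split u v by (auto simp: split_over_reals_def)
    then have "complex_form Q (conj_vec u) (conj_vec v) = 0" using 2 by (rule F_high)
    then show ?thesis by (simp flip: cnj_complex_form)
  next
    case 3
    have "u \<in> complexify (W (p + q - w))" unfolding W by (rule piece_in_span[OF u]) simp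
    moreover have "v \<in> complexify (W (r + s - w))" unfolding W by (rule piece_in_span[OF v]) simp
    ultimately show ?thesis using QW[OF _ _ 3] by (rule complex_form_complexify_eq_0[OF Q, rotated])
  qed
qed

end

theorem lemma3p5:
  fixes w :: int
    and VQ :: "(real^'n) set"
    and Q :: "real^'n \<Rightarrow> real^'n \<Rightarrow> real"
    and h :: "int \<Rightarrow> nat"
    and F :: "int \<Rightarrow> (complex^'n) set"
    and N :: "real^'n^'n"
    and V :: "int \<Rightarrow> int \<Rightarrow> (complex^'n) set"
    and M :: "(real^'n^'n) set"
  assumes "rational_structure VQ"
    and "polarization_form w VQ Q"
    and "hodge_numbers w h CARD('n)"
    and "nilpotent_orbit w Q h F N"
    and "deligne_bigrading F (shifted_weight_filtration w N) V"
    and "split_over_reals V"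
    and "connected_lie_subgroup (aut_group Q) M"
    and "lie_algebra_of M = lie_g_diag_real Q V 0"
  shows "openin (top_of_set (lie_g_diag_real Q V (-1))) (Ad_orbit M N)
    \<and> connected_component_set (same_weight_locus Q V N) N = Ad_orbit M N"
proof -
  let ?W = "weight_filtration N"
  note split = \<open>split_over_reals V\<close>
  have bilinear: "bilinear Q" and sym: "\<And>x y. Q y x = (-1) powi w * Q x y"
    and nondeg: "\<And>x. (\<And>y. Q x y = 0) \<Longrightarrow> x = 0"
    using assms(2) unfolding polarization_form_def by blast+
  have N_lie: "N \<in> lie_g_real Q" and nil: "mat_nilpotent N"
    and NF: "\<And>p v. v \<in> F p \<Longrightarrow> cmat N *v v \<in> F (p - 1)"
    and QF: "\<And>p u v. u \<in> F p \<Longrightarrow> v \<in> F (w + 1 - p) \<Longrightarrow> complex_form Q u v = 0"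
    using assms(4) unfolding nilpotent_orbit_def compact_dual_def by blast+
  have V: "bigrading V" and F: "\<And>p. F p = vec.span (\<Union>{V r s | r s. r \<ge> p})"
    and W: "\<And>k. complexify (?W (k - w)) = vec.span (\<Union>{V r s | r s. r + s \<le> k})"
    using assms(5) unfolding deligne_bigrading_def shifted_weight_filtration_def by blast+
  have W': "complexify (?W k) = vec.span (\<Union>{V r s | r s. r + s \<le> k + w})" for k
    using W[of "k + w"] by simp
  note W_eq = weight_filtration_eq_kernel_filtration[OF nil]
  have NW: "N *v x \<in> ?W (k - 2)" if "x \<in> ?W k" for k x
    using kernel_filtration_shift that by (simp add: W_eq)
  obtain S P where "projected_bigrading V S P"
    using bigrading_projections[OF V] .
  then interpret projected_bigrading V S P .
  have "N *v x \<in> ?W (k - 2 - w)" if "x \<in> ?W (k - w)" for k x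
    using NW[OF that] by (simp add: algebra_simps)
  then have N_type: "cmat N *v v \<in> V (p - 1) (q - 1)" if "v \<in> V p q" for p q v
    using lowers_both_degrees[OF split F W NF _ that] by blast
  have QW: "Q x y = 0" if "x \<in> ?W k" "y \<in> ?W l" "k + l < 0" for k l x y
    using kernel_filtration_orthogonal[OF bilinear N_lie] that by (simp add: W_eq)
  have orth: "complex_form Q u v = 0"
    if "u \<in> V p q" "v \<in> V r s" "\<not> (p + r = w \<and> q + s = w)" for p q r s u v
    by (rule pieces_orthogonal[OF split F W' _ bilinear _ that]; (fact QF | fact QW))
  interpret bigraded_centralizer V S P w Q "(-1) powi w" N M
  proof unfold_locales
    show "N \<in> lie_g_diag_real Q V (-1)"
      using N_lie N_type
      by (auto simp: lie_g_diag_real_def lie_g_bigraded_def cmat_in_lie_g_complex_iff[OF bilinear])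
    show "x = 0" if "\<And>y. Q x y = 0" for x
      using that by (rule nondeg)
  qed (fact bilinear sym split orth nil W' assms(7,8))+
  have "N \<in> same_weight_locus Q V N" using N_type by (simp add: same_weight_locus_def)
  then show ?thesis using openin_Ad_orbit component_eq_orbit by blast
qed

end
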